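(* Fix an integer $m\ge1$. Let $\mathcal P_n$ be the total number of pairs of parallel edges in $G_m^n$, that is, the number of unordered pairs of distinct non-loop edges of $G_m^n$ having the same two (distinct) endpoints. Then with high probability $\mathcal P_n$ is asymptotic to $\frac{m^2-1}{16}\log^2 n$, i.e. $$\frac{\mathcal P_n}{\log^2 n}\longrightarrow\frac{m^2-1}{16}\quad\text{in probability as } n\to\infty.$$ Thus with high probability the operation of identifying parallel edges (replacing every class of parallel edges by a single edge) reduces the edge count by $\Theta(\log^2n)$.
   Context: Bollobás–Riordan preferential attachment multigraph $G_m^n$. Let $w_1,\dots,w_{mn+1}$ be independent exponential random variables with mean $1$, $W_k=\sum_{i=1}^k w_i$, $W_0=0$. Put $R_k=W_k/W_{mn+1}$ for $k=1,\dots,mn$, $R_0=0$. Conditionally on $\mathbf W=\{W_k\}$, let $\ell_1,\dots,\ell_{mn}$ be independent, $\ell_k$ having density $\frac{1}{2\sqrt{R_k x}}$ on $(0,R_k]$. The vertex set of $G_m^n$ is $[n]=\{1,\dots,n\}$; vertex $j$ is identified with the interval $(R_{m(j-1)},R_{mj}]$. For each $k\in[mn]$ there is one edge joining the vertex containing $R_k$ with the vertex containing $\ell_k$ (a loop if these coincide). "With high probability" means with probability tending to $1$ as $n\to\infty$.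
   Formalization: The lower half of the Θ(log² n) bound on the edge-count reduction is stated only for m ≥ 2, since for m = 1 there are almost surely no parallel edges and the reduction is 0; the limit in probability and the O(log² n) bound are for all m ≥ 1. *)

theory Defs
  imports "HOL-Probability.Probability"
begin

text \<open>
  A multigraph is a set \<open>E\<close> of edge names with a map \<open>ends\<close> sending an edge to the set of its
  endpoints; this set is a singleton exactly when the edge is a loop. Loops are never parallel.
\<close>

definition parallel_edges :: "('e \<Rightarrow> 'v set) \<Rightarrow> 'e \<Rightarrow> 'e \<Rightarrow> bool" where
  "parallel_edges ends j k \<longleftrightarrow> j \<noteq> k \<and> card (ends j) = 2 \<and> ends j = ends k"

definition num_parallel_pairs :: "'e set \<Rightarrow> ('e \<Rightarrow> 'v set) \<Rightarrow> nat" where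
  "num_parallel_pairs E ends = card {{j, k} | j k. j \<in> E \<and> k \<in> E \<and> parallel_edges ends j k}"

definition identified_edges :: "'e set \<Rightarrow> ('e \<Rightarrow> 'v set) \<Rightarrow> 'e set set" where
  "identified_edges E ends = E // {(j, k). j \<in> E \<and> k \<in> E \<and> (j = k \<or> parallel_edges ends j k)}"

definition edge_reduction :: "'e set \<Rightarrow> ('e \<Rightarrow> 'v set) \<Rightarrow> real" where
  "edge_reduction E ends = real (card E) - real (card (identified_edges E ends))"

text \<open>In the following, \<open>N\<close> stands for the number \<open>m * n\<close> of edges.\<close>

definition partial_W :: "(nat \<Rightarrow> 'a \<Rightarrow> real) \<Rightarrow> nat \<Rightarrow> 'a \<Rightarrow> real" where
  "partial_W w k \<omega> = (\<Sum>i=1..k. w i \<omega>)"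

definition ratio_R :: "nat \<Rightarrow> (nat \<Rightarrow> 'a \<Rightarrow> real) \<Rightarrow> nat \<Rightarrow> 'a \<Rightarrow> real" where
  "ratio_R N w k \<omega> = partial_W w k \<omega> / partial_W w (N + 1) \<omega>"

definition attach_density :: "real \<Rightarrow> real \<Rightarrow> real" where
  "attach_density r x = (if 0 < x \<and> x \<le> r then 1 / (2 * sqrt (r * x)) else 0)"

definition sigma_W :: "'a measure \<Rightarrow> nat \<Rightarrow> (nat \<Rightarrow> 'a \<Rightarrow> real) \<Rightarrow> 'a measure" where
  "sigma_W M N w =
     vimage_algebra (space M) (\<lambda>\<omega>. \<lambda>k\<in>{1..N + 1}. partial_W w k \<omega>)
       (Pi\<^sub>M {1..N + 1} (\<lambda>_. borel))"

text \<open>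
  The assumption \<open>cond_law\<close> says that, conditionally on the sigma-algebra generated by the \<open>W k\<close>,
  the \<open>l k\<close> are independent and \<open>l k\<close> has density \<open>attach_density (R k)\<close>.
\<close>

locale bollobas_riordan = prob_space M for M :: "'a measure" +
  fixes m n :: nat and w l :: "nat \<Rightarrow> 'a \<Rightarrow> real"
  assumes w_indep: "indep_vars (\<lambda>_. borel) w {1..m * n + 1}"
    and w_exponential:
      "\<And>i. i \<in> {1..m * n + 1} \<Longrightarrow> distributed M lborel (w i) (exponential_density 1)"
    and l_measurable: "\<And>k. k \<in> {1..m * n} \<Longrightarrow> random_variable borel (l k)"
    and cond_law:
      "\<And>B. (\<And>k. k \<in> {1..m * n} \<Longrightarrow> B k \<in> sets borel) \<Longrightarrow>
        AE \<omega> in M.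
          real_cond_exp M (sigma_W M (m * n) w)
            (indicator {\<omega> \<in> space M. \<forall>k\<in>{1..m * n}. l k \<omega> \<in> B k}) \<omega> =
          (\<Prod>k=1..m * n.
             measure (density lborel (attach_density (ratio_R (m * n) w k \<omega>))) (B k))"

definition vertex_of :: "nat \<Rightarrow> nat \<Rightarrow> (nat \<Rightarrow> 'a \<Rightarrow> real) \<Rightarrow> 'a \<Rightarrow> real \<Rightarrow> nat" where
  "vertex_of m n w \<omega> x =
     (THE j. j \<in> {1..n} \<and>
        x \<in> {ratio_R (m * n) w (m * (j - 1)) \<omega><..ratio_R (m * n) w (m * j) \<omega>})"

definition br_ends ::
    "nat \<Rightarrow> nat \<Rightarrow> (nat \<Rightarrow> 'a \<Rightarrow> real) \<Rightarrow> (nat \<Rightarrow> 'a \<Rightarrow> real) \<Rightarrow> 'a \<Rightarrow> nat \<Rightarrow> nat set" where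
  "br_ends m n w l \<omega> k =
     {vertex_of m n w \<omega> (ratio_R (m * n) w k \<omega>), vertex_of m n w \<omega> (l k \<omega>)}"

definition br_parallel_pairs ::
    "nat \<Rightarrow> nat \<Rightarrow> (nat \<Rightarrow> 'a \<Rightarrow> real) \<Rightarrow> (nat \<Rightarrow> 'a \<Rightarrow> real) \<Rightarrow> 'a \<Rightarrow> nat" where
  "br_parallel_pairs m n w l \<omega> = num_parallel_pairs {1..m * n} (br_ends m n w l \<omega>)"

definition br_edge_reduction ::
    "nat \<Rightarrow> nat \<Rightarrow> (nat \<Rightarrow> 'a \<Rightarrow> real) \<Rightarrow> (nat \<Rightarrow> 'a \<Rightarrow> real) \<Rightarrow> 'a \<Rightarrow> real" where
  "br_edge_reduction m n w l \<omega> = edge_reduction {1..m * n} (br_ends m n w l \<omega>)"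

definition with_high_probability ::
    "(nat \<Rightarrow> 'a measure) \<Rightarrow> (nat \<Rightarrow> 'a \<Rightarrow> bool) \<Rightarrow> bool" where
  "with_high_probability M Q \<longleftrightarrow>
     (\<lambda>n. measure (M n) {\<omega> \<in> space (M n). Q n \<omega>}) \<longlonglongrightarrow> 1"

definition tendsto_in_probability ::
    "(nat \<Rightarrow> 'a measure) \<Rightarrow> (nat \<Rightarrow> 'a \<Rightarrow> real) \<Rightarrow> real \<Rightarrow> bool" where
  "tendsto_in_probability M X c \<longleftrightarrow>
     (\<forall>\<epsilon>>0. (\<lambda>n. measure (M n) {\<omega> \<in> space (M n). \<bar>X n \<omega> - c\<bar> > \<epsilon>}) \<longlonglongrightarrow> 0)"

end

theory Submission
  imports Defs
begin

text \<open>
  Write \<open>l k = R k * (u k)\<^sup>2\<close> with \<open>u k\<close> uniform on \<open>(0, 1]\<close>, independent of each other and of \<open>w\<close>.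
  Two edges are parallel iff they start in the same block \<open>i\<close> of \<open>m\<close> consecutive edges and attach to
  the same vertex \<open>j < i\<close>. Given \<open>w\<close>, the number of parallel pairs is therefore a sum of independent
  bounded contributions of the blocks, with conditional mean
  \<open>Y = (\<Sum>i. \<Sum>(k, k') in block i. \<Sum>j<i. (sqrt (W (m j)) - sqrt (W (m (j - 1))))\<^sup>2 / sqrt (W k * W k'))\<close>,
  and its conditional variance is at most a constant times \<open>Y\<close>; so it suffices that
  \<open>Y / ln\<^sup>2 n\<close> tends to \<open>(m\<^sup>2 - 1) / 16\<close> in probability.

  By a fourth moment bound, with probability close to \<open>1\<close> all \<open>W (m i)\<close> with \<open>i\<close> beyond a large constant
  \<open>a\<close> are within a factor \<open>1 \<plusminus> \<delta>\<close> of \<open>m i\<close>. On this event \<open>Y\<close> is, up to a factor close to \<open>1\<close> and an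
  error \<open>O(ln n)\<close>, equal to \<open>(m - 1) / (8 m)\<close> times \<open>T = (\<Sum>a<j<i\<le>n. D j\<^sup>2 / (i j))\<close>, where the
  \<open>D j = W (m j) - W (m (j - 1))\<close> are independent with \<open>E (D j\<^sup>2) = m (m + 1)\<close>. Chebyshev's inequality
  gives \<open>T \<sim> m (m + 1) / 2 * ln\<^sup>2 n\<close>.

  Identifying parallel edges removes at most one edge per parallel pair, and at least one edge per
  \<open>m\<close> parallel pairs because a class of parallel edges has at most \<open>m\<close> elements.
\<close>

section \<open>Parallel edges of a multigraph\<close>

lemma parallel_edges_commute: "parallel_edges ends j k \<longleftrightarrow> parallel_edges ends k j"
  by (auto simp: parallel_edges_def)

lemma parallel_edges_cong:
  "ends j = ends' j \<Longrightarrow> ends k = ends' k \<Longrightarrow> parallel_edges ends j k \<longleftrightarrow> parallel_edges ends' j k"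
  by (simp add: parallel_edges_def)

lemma num_parallel_pairs_restrict: "num_parallel_pairs E (restrict ends E)
    = num_parallel_pairs E ends"
proof -
  have "{{j, k} | j k. j \<in> E \<and> k \<in> E \<and> parallel_edges (restrict ends E) j k}
      = {{j, k} | j k. j \<in> E \<and> k \<in> E \<and> parallel_edges ends j k}"
    using parallel_edges_cong[of "restrict ends E" _ ends] by (intro Collect_cong ex_cong1) auto
  then show ?thesis by (simp add: num_parallel_pairs_def)
qed

lemma edge_reduction_restrict: "edge_reduction E (restrict ends E) = edge_reduction E ends"
proof -
  have "{(j, k). j \<in> E \<and> k \<in> E \<and> (j = k \<or> parallel_edges (restrict ends E) j k)}
      = {(j, k). j \<in> E \<and> k \<in> E \<and> (j = k \<or> parallel_edges ends j k)}"
    using parallel_edges_cong[of "restrict ends E" _ ends] by auto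
  then show ?thesis by (simp add: edge_reduction_def identified_edges_def)
qed

lemma card_unordered_pairs_eq_ordered:
  fixes A :: "'a::linorder set"
  assumes r: "\<And>x y. r x y \<Longrightarrow> r y x" "\<And>x. \<not> r x x"
  shows "card {{x, y} | x y. x \<in> A \<and> y \<in> A \<and> r x y} = card {(x, y). x \<in> A \<and> y \<in> A \<and> x < y \<and> r x y}"
proof -
  let ?S = "{(x, y). x \<in> A \<and> y \<in> A \<and> x < y \<and> r x y}"
  have "{{x, y} | x y. x \<in> A \<and> y \<in> A \<and> r x y} = (\<lambda>(x, y). {x, y}) ` ?S"
  proof (intro equalityI subsetI)
    fix p assume "p \<in> {{x, y} | x y. x \<in> A \<and> y \<in> A \<and> r x y}"
    then obtain x y where p: "p = {x, y}" "x \<in> A" "y \<in> A" "r x y" by blast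
    then have "x < y \<or> y < x" using r(2) neq_iff by blast
    then have "(x, y) \<in> ?S \<or> (y, x) \<in> ?S" using p r(1) by auto
    then show "p \<in> (\<lambda>(x, y). {x, y}) ` ?S" using p(1) by (auto simp: insert_commute)
  qed auto
  moreover have "inj_on (\<lambda>(x, y). {x, y}) ?S"
    by (auto simp: inj_on_def doubleton_eq_iff)
  ultimately show ?thesis by (simp add: card_image)
qed

lemma num_parallel_pairs_eq_card:
  fixes E :: "'e::linorder set"
  shows "num_parallel_pairs E ends = card {(j, k). j \<in> E \<and> k \<in> E \<and> j < k \<and> parallel_edges ends j k}"
  unfolding num_parallel_pairs_def
  by (rule card_unordered_pairs_eq_ordered) (auto simp: parallel_edges_def)

lemma num_parallel_pairs_eq_sum:
  fixes E :: "'e::linorder set"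
  assumes "finite E"
  shows "num_parallel_pairs E ends = (\<Sum>k\<in>E. card {j\<in>E. j < k \<and> parallel_edges ends j k})"
proof -
  have "card {(j, k). j \<in> E \<and> k \<in> E \<and> j < k \<and> parallel_edges ends j k}
      = card (SIGMA k:E. {j\<in>E. j < k \<and> parallel_edges ends j k})"
    by (intro bij_betw_same_card[of prod.swap]) (auto simp: bij_betw_def inj_on_def image_def)
  then show ?thesis using assms by (simp add: num_parallel_pairs_eq_card)
qed

lemma card_quotient_eq_card_least:
  fixes A :: "'a::linorder set"
  assumes A: "finite A" and r: "equiv A r"
  shows "card (A // r) = card {x\<in>A. \<forall>y\<in>A. (y, x) \<in> r \<longrightarrow> x \<le> y}"
proof -
  let ?L = "{x\<in>A. \<forall>y\<in>A. (y, x) \<in> r \<longrightarrow> x \<le> y}"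
  have "inj_on (\<lambda>x. r `` {x}) ?L"
  proof (rule inj_onI)
    fix x y assume xy: "x \<in> ?L" "y \<in> ?L" "r `` {x} = r `` {y}"
    then have "(x, y) \<in> r" by (intro eq_equiv_class[OF _ r]) auto
    moreover from this have "(y, x) \<in> r" using r by (auto simp: equiv_def sym_def)
    ultimately show "x = y" using xy by (intro antisym) auto
  qed
  moreover have "(\<lambda>x. r `` {x}) ` ?L = A // r"
  proof (intro equalityI subsetI)
    fix C assume C: "C \<in> A // r"
    have "C \<subseteq> A" "C \<noteq> {}" using C r in_quotient_imp_subset in_quotient_imp_non_empty by blast+
    from \<open>C \<subseteq> A\<close> A have fin: "finite C" by (rule finite_subset)
    then have min: "Min C \<in> C" using \<open>C \<noteq> {}\<close> by (rule Min_in)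
    then have "r `` {Min C} = C" using r C by (metis Image_singleton_iff quotientE equiv_class_eq)
    moreover have "Min C \<le> y" if "(y, Min C) \<in> r" for y
    proof -
      have "(Min C, y) \<in> r" using r that by (meson equivE symE)
      then have "y \<in> C" using \<open>r `` {Min C} = C\<close> by blast
      then show ?thesis using fin by simp
    qed
    ultimately show "C \<in> (\<lambda>x. r `` {x}) ` ?L" using min \<open>C \<subseteq> A\<close> by blast
  qed (auto simp: quotient_def)
  ultimately show ?thesis using card_image by fastforce
qed

lemma edge_reduction_eq_card:
  fixes E :: "'e::linorder set"
  assumes "finite E"
  shows "edge_reduction E ends = real (card {k\<in>E. \<exists>j\<in>E. j < k \<and> parallel_edges ends j k})"
proof -
  define r where "r = {(j, k). j \<in> E \<and> k \<in> E \<and> (j = k \<or> parallel_edges ends j k)}"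
  let ?N = "{k\<in>E. \<exists>j\<in>E. j < k \<and> parallel_edges ends j k}"
  have "equiv E r"
    by (rule equivI) (auto simp: r_def refl_on_def sym_def trans_def parallel_edges_def)
  then have "card (identified_edges E ends) = card {k\<in>E. \<forall>j\<in>E. (j, k) \<in> r \<longrightarrow> k \<le> j}"
    using assms by (simp add: identified_edges_def r_def card_quotient_eq_card_least)
  also have "{k\<in>E. \<forall>j\<in>E. (j, k) \<in> r \<longrightarrow> k \<le> j} = E - ?N"
    by (auto simp: r_def not_le)
  also have "card \<dots> = card E - card ?N"
    using assms by (intro card_Diff_subset) auto
  finally have "card (identified_edges E ends) = card E - card ?N" .
  moreover have "card ?N \<le> card E" using assms by (intro card_mono) auto
  ultimately show ?thesis by (simp add: edge_reduction_def of_nat_diff)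
qed

lemma edge_reduction_le_num_parallel_pairs:
  fixes E :: "'e::linorder set"
  assumes "finite E"
  shows "edge_reduction E ends \<le> real (num_parallel_pairs E ends)"
proof -
  have "card {k\<in>E. \<exists>j\<in>E. j < k \<and> parallel_edges ends j k}
      = (\<Sum>k\<in>E. if \<exists>j\<in>E. j < k \<and> parallel_edges ends j k then 1 else 0)"
    using assms by (simp add: sum.If_cases Collect_conj_eq)
  also have "\<dots> \<le> (\<Sum>k\<in>E. card {j\<in>E. j < k \<and> parallel_edges ends j k})"
    using assms by (intro sum_mono) (auto simp: Suc_le_eq card_gt_0_iff)
  finally show ?thesis
    using assms
    by (simp add: edge_reduction_eq_card num_parallel_pairs_eq_sum del: of_nat_sum)
qed

lemma num_parallel_pairs_le_edge_reduction:
  fixes E :: "'e::linorder set"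
  assumes "finite E" and d: "\<And>k. k \<in> E \<Longrightarrow> card {j\<in>E. j < k \<and> parallel_edges ends j k} \<le> d"
  shows "real (num_parallel_pairs E ends) \<le> real d * edge_reduction E ends"
proof -
  have "num_parallel_pairs E ends \<le> (\<Sum>k\<in>E. if \<exists>j\<in>E. j < k \<and> parallel_edges ends j k then d else 0)"
    unfolding num_parallel_pairs_eq_sum[OF assms(1)]
    using assms by (intro sum_mono) (auto simp: card_eq_0_iff)
  also have "\<dots> = d * card {k\<in>E. \<exists>j\<in>E. j < k \<and> parallel_edges ends j k}"
    using assms by (simp add: sum.If_cases Collect_conj_eq)
  finally show ?thesis
    using assms(1) by (simp add: edge_reduction_eq_card flip: of_nat_mult)
qed

section \<open>Sums of independent random variables\<close>

lemma (in prob_space) variance_le_second_moment: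
  fixes X :: "'a \<Rightarrow> real"
  assumes "random_variable borel X" "integrable M (\<lambda>x. (X x)\<^sup>2)"
  shows "variance X \<le> expectation (\<lambda>x. (X x)\<^sup>2)"
  using variance_eq[OF square_integrable_imp_integrable[OF assms] assms(2)] by simp

lemma (in prob_space)
  fixes X Y :: "'a \<Rightarrow> real"
  assumes indep: "indep_var borel X borel Y"
    and square_X: "integrable M (\<lambda>x. (X x)\<^sup>2)" and square_Y: "integrable M (\<lambda>x. (Y x)\<^sup>2)"
  shows integrable_square_add_indep: "integrable M (\<lambda>x. (X x + Y x)\<^sup>2)"
    and variance_add_indep: "variance (\<lambda>x. X x + Y x) = variance X + variance Y"
proof -
  have [measurable]: "random_variable borel X" "random_variable borel Y"
    using indep by (auto dest: indep_var_rv1 indep_var_rv2)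
  have int_X: "integrable M X" and int_Y: "integrable M Y"
    using square_X square_Y by (auto intro: square_integrable_imp_integrable)
  have int_prod: "integrable M (\<lambda>x. X x * Y x)"
    using indep int_X int_Y by (rule indep_var_integrable)
  have square_add: "(X x + Y x)\<^sup>2 = (X x)\<^sup>2 + (Y x)\<^sup>2 + 2 * (X x * Y x)" for x
    by (simp add: power2_sum)
  show square_int: "integrable M (\<lambda>x. (X x + Y x)\<^sup>2)"
    unfolding square_add using square_X square_Y int_prod by simp
  have "expectation (\<lambda>x. (X x + Y x)\<^sup>2)
      = expectation (\<lambda>x. (X x)\<^sup>2) + expectation (\<lambda>x. (Y x)\<^sup>2) + 2 * (expectation X * expectation Y)"
    unfolding square_add using square_X square_Y int_prod
    by (simp add: indep_var_lebesgue_integral[OF indep int_X int_Y])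
  moreover have "variance (\<lambda>x. X x + Y x)
      = expectation (\<lambda>x. (X x + Y x)\<^sup>2) - (expectation X + expectation Y)\<^sup>2"
    using int_X int_Y square_int by (subst variance_eq) auto
  ultimately show "variance (\<lambda>x. X x + Y x) = variance X + variance Y"
    using int_X int_Y square_X square_Y by (simp add: variance_eq power2_sum)
qed

lemma (in prob_space)
  fixes X :: "'i \<Rightarrow> 'a \<Rightarrow> real"
  assumes "finite I" "indep_vars (\<lambda>_. borel) X I" "\<And>i. i \<in> I \<Longrightarrow> integrable M (\<lambda>x. (X i x)\<^sup>2)"
  shows integrable_square_sum_indep: "integrable M (\<lambda>x. (\<Sum>i\<in>I. X i x)\<^sup>2)"
    and variance_sum_indep: "variance (\<lambda>x. \<Sum>i\<in>I. X i x) = (\<Sum>i\<in>I. variance (X i))"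
proof -
  have "integrable M (\<lambda>x. (\<Sum>i\<in>I. X i x)\<^sup>2) \<and> variance (\<lambda>x. \<Sum>i\<in>I. X i x) = (\<Sum>i\<in>I. variance (X i))"
    using assms
  proof (induction I rule: finite_induct)
    case (insert i I)
    have "indep_vars (\<lambda>_. borel) X I" using insert.prems(1) by (rule indep_vars_subset) auto
    then have IH: "integrable M (\<lambda>x. (\<Sum>i\<in>I. X i x)\<^sup>2)"
        "variance (\<lambda>x. \<Sum>i\<in>I. X i x) = (\<Sum>i\<in>I. variance (X i))"
      using insert.IH insert.prems(2) by auto
    have indep: "indep_var borel (X i) borel (\<lambda>x. \<Sum>i\<in>I. X i x)"
      using insert.hyps insert.prems(1) by (rule indep_vars_sum)
    have "integrable M (\<lambda>x. (X i x)\<^sup>2)" using insert.prems(2) by simp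
    from integrable_square_add_indep[OF indep this IH(1)] variance_add_indep[OF indep this IH(1)] IH(2)
    show ?case by (simp only: sum.insert[OF insert.hyps] simp_thms)
  qed simp
  then show "integrable M (\<lambda>x. (\<Sum>i\<in>I. X i x)\<^sup>2)"
    "variance (\<lambda>x. \<Sum>i\<in>I. X i x) = (\<Sum>i\<in>I. variance (X i))"
    by blast+
qed

lemma (in prob_space) prob_sum_deviation_le:
  fixes X :: "'i \<Rightarrow> 'a \<Rightarrow> real"
  assumes fin: "finite I" and indep: "indep_vars (\<lambda>_. borel) X I"
    and square_int: "\<And>i. i \<in> I \<Longrightarrow> integrable M (\<lambda>x. (X i x)\<^sup>2)" and a: "a > 0"
  shows "prob {x\<in>space M. \<bar>(\<Sum>i\<in>I. X i x) - (\<Sum>i\<in>I. expectation (X i))\<bar> \<ge> a}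
    \<le> (\<Sum>i\<in>I. expectation (\<lambda>x. (X i x)\<^sup>2)) / a\<^sup>2"
proof -
  have rv [measurable]: "random_variable borel (X i)" if "i \<in> I" for i
    using indep that unfolding indep_vars_def by blast
  have "integrable M (X i)" if "i \<in> I" for i
    using rv[OF that] square_int[OF that] by (rule square_integrable_imp_integrable)
  then have "(\<Sum>i\<in>I. expectation (X i)) = expectation (\<lambda>x. \<Sum>i\<in>I. X i x)"
    by (simp add: Bochner_Integration.integral_sum)
  then have "prob {x\<in>space M. \<bar>(\<Sum>i\<in>I. X i x) - (\<Sum>i\<in>I. expectation (X i))\<bar> \<ge> a}
      \<le> variance (\<lambda>x. \<Sum>i\<in>I. X i x) / a\<^sup>2"
    using integrable_square_sum_indep[OF fin indep square_int] a
    by (simp only:) (intro Chebyshev_inequality, auto)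
  also have "variance (\<lambda>x. \<Sum>i\<in>I. X i x) = (\<Sum>i\<in>I. variance (X i))"
    using fin indep square_int by (rule variance_sum_indep)
  also have "(\<Sum>i\<in>I. variance (X i)) / a\<^sup>2 \<le> (\<Sum>i\<in>I. expectation (\<lambda>x. (X i x)\<^sup>2)) / a\<^sup>2"
    using square_int by (intro divide_right_mono sum_mono variance_le_second_moment) auto
  finally show ?thesis .
qed

lemma (in prob_space) prob_sum_bounded_deviation_le:
  fixes X :: "'i \<Rightarrow> 'a \<Rightarrow> real"
  assumes fin: "finite I" and indep: "indep_vars (\<lambda>_. borel) X I"
    and nonneg: "\<And>i x. i \<in> I \<Longrightarrow> 0 \<le> X i x" and bound: "\<And>i x. i \<in> I \<Longrightarrow> X i x \<le> b" and a: "a > 0"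
  shows "prob {x\<in>space M. \<bar>(\<Sum>i\<in>I. X i x) - (\<Sum>i\<in>I. expectation (X i))\<bar> \<ge> a}
    \<le> b * (\<Sum>i\<in>I. expectation (X i)) / a\<^sup>2"
proof -
  have [measurable]: "random_variable borel (X i)" if "i \<in> I" for i
    using indep that unfolding indep_vars_def by blast
  have square_le: "(X i x)\<^sup>2 \<le> b * X i x" "(X i x)\<^sup>2 \<le> b\<^sup>2" if "i \<in> I" for i x
    using nonneg[OF that, of x] bound[OF that, of x]
    by (auto simp: power2_eq_square intro!: mult_right_mono mult_mono)
  have int: "integrable M (X i)" and square_int: "integrable M (\<lambda>x. (X i x)\<^sup>2)" if "i \<in> I" for i
    using that nonneg[OF that] bound[OF that] square_le(2)[OF that]
    by (intro integrable_const_bound[where B=b] integrable_const_bound[where B="b\<^sup>2"]; simp)+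
  have "prob {x\<in>space M. \<bar>(\<Sum>i\<in>I. X i x) - (\<Sum>i\<in>I. expectation (X i))\<bar> \<ge> a}
      \<le> (\<Sum>i\<in>I. expectation (\<lambda>x. (X i x)\<^sup>2)) / a\<^sup>2"
    using fin indep square_int a by (rule prob_sum_deviation_le)
  also have "\<dots> \<le> (\<Sum>i\<in>I. b * expectation (X i)) / a\<^sup>2"
  proof (intro divide_right_mono sum_mono)
    fix i assume "i \<in> I"
    then have "expectation (\<lambda>x. (X i x)\<^sup>2) \<le> expectation (\<lambda>x. b * X i x)"
      using square_le int square_int by (intro integral_mono) auto
    then show "expectation (\<lambda>x. (X i x)\<^sup>2) \<le> b * expectation (X i)" by simp
  qed simp
  finally show ?thesis by (simp add: sum_distrib_left)
qed

lemma (in prob_space) indep_vars_sum_disjoint: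
  fixes X :: "'i \<Rightarrow> 'a \<Rightarrow> real"
  assumes "indep_vars (\<lambda>_. borel) X I" "disjoint_family_on K J" "\<And>j. j \<in> J \<Longrightarrow> K j \<subseteq> I"
  shows "indep_vars (\<lambda>_. borel) (\<lambda>j x. \<Sum>i\<in>K j. X i x) J"
proof -
  have "indep_vars (\<lambda>_. borel) (\<lambda>j x. \<Sum>i\<in>K j. restrict (\<lambda>i. X i x) (K j) i) J"
    using indep_vars_restrict[OF assms(1,3,2)] by (rule indep_vars_compose2) measurable
  then show ?thesis by simp
qed

section \<open>Product measures\<close>

lemma measure_PiM_Collect_ball:
  assumes "finite I" and M: "\<And>i. prob_space (M i)"
      and sets: "\<And>i. i \<in> I \<Longrightarrow> {x\<in>space (M i). P i x} \<in> sets (M i)"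
  shows "measure (Pi\<^sub>M I M) {x\<in>space (Pi\<^sub>M I M). \<forall>i\<in>I. P i (x i)}
      = (\<Prod>i\<in>I. measure (M i) {x\<in>space (M i). P i x})"
proof -
  interpret product_prob_space M I
    using M
    by (simp add: product_prob_space_def product_prob_space_axioms_def product_sigma_finite_def
        prob_space_imp_sigma_finite)
  interpret finite_product_prob_space M I by standard fact
  have "{x\<in>space (Pi\<^sub>M I M). \<forall>i\<in>I. P i (x i)} = (\<Pi>\<^sub>E i\<in>I. {x\<in>space (M i). P i x})"
    by (auto simp: space_PiM PiE_iff extensional_def)
  also have "measure (Pi\<^sub>M I M) \<dots> = (\<Prod>i\<in>I. measure (M i) {x\<in>space (M i). P i x})"
    using sets by (rule finite_measure_PiM_emb)
  finally show ?thesis .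
qed

lemma measure_eqI_pair_PiM:
  assumes "finite I" "finite_measure P"
    and sets: "sets P = sets (S \<Otimes>\<^sub>M Pi\<^sub>M I M)" "sets Q = sets (S \<Otimes>\<^sub>M Pi\<^sub>M I M)"
    and eq: "\<And>A B. A \<in> sets S \<Longrightarrow> (\<And>i. i \<in> I \<Longrightarrow> B i \<in> sets (M i)) \<Longrightarrow>
      emeasure P (A \<times> Pi\<^sub>E I B) = emeasure Q (A \<times> Pi\<^sub>E I B)"
  shows "P = Q"
proof (rule measure_eqI_generator_eq)
  let ?E = "{a \<times> b | a b. a \<in> sets S \<and> b \<in> prod_algebra I M}"
  let ?\<Omega> = "space S \<times> space (Pi\<^sub>M I M)"
  have space: "space S \<in> sets S" "space (Pi\<^sub>M I M) \<in> prod_algebra I M"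
    using \<open>finite I\<close> by (auto simp: space_PiM intro!: prod_algebraI_finite)
  have prod_algebra: "prod_algebra I M \<subseteq> Pow (space (Pi\<^sub>M I M))"
    by (simp add: space_PiM prod_algebra_sets_into_space)
  then show subset: "?E \<subseteq> Pow ?\<Omega>"
    by (blast dest: sets.sets_into_space)
  have "sets (S \<Otimes>\<^sub>M Pi\<^sub>M I M) = sets (sigma ?\<Omega> ?E)"
  proof (rule sets_pair_eq)
    show "sets (Pi\<^sub>M I M) = sigma_sets (space (Pi\<^sub>M I M)) (prod_algebra I M)"
      by (simp add: sets_PiM space_PiM)
    show "countable {space S}" "countable {space (Pi\<^sub>M I M)}" by simp_all
  qed (use space prod_algebra sets.space_closed in \<open>auto simp: sets.sigma_sets_eq dest: sets.sets_into_space\<close>)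
  then show "sets P = sigma_sets ?\<Omega> ?E" "sets Q = sigma_sets ?\<Omega> ?E"
    using sets subset by simp_all
  show "Int_stable ?E"
  proof (rule Int_stableI)
    fix x y assume "x \<in> ?E" "y \<in> ?E"
    then obtain a b a' b' where "x = a \<times> b" "y = a' \<times> b'" "a \<in> sets S" "a' \<in> sets S"
      "b \<in> prod_algebra I M" "b' \<in> prod_algebra I M" by auto
    moreover from this have "b \<inter> b' \<in> prod_algebra I M"
      using Int_stable_prod_algebra by (blast dest: Int_stableD)
    ultimately show "x \<inter> y \<in> ?E" by (auto simp: Times_Int_Times)
  qed
  show "emeasure P X = emeasure Q X" if "X \<in> ?E" for X
    using that eq by (auto simp: prod_algebra_eq_finite[OF \<open>finite I\<close>] Pi_iff)
  show "range (\<lambda>_::nat. ?\<Omega>) \<subseteq> ?E" using space by blast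
  show "emeasure P ?\<Omega> \<noteq> \<infinity>" for i :: nat
    using \<open>finite_measure P\<close> by (simp add: finite_measure.emeasure_finite)
qed simp

lemma indep_vars_PiM_coordinates:
  assumes M: "\<And>i. prob_space (M i)"
  shows "prob_space.indep_vars (Pi\<^sub>M I M) M (\<lambda>i x. x i) I"
proof -
  interpret P: prob_space "Pi\<^sub>M I M" by (rule prob_space_PiM) (rule M)
  have "distr (Pi\<^sub>M I M) (Pi\<^sub>M I M) (\<lambda>x. \<lambda>i\<in>I. x i) = distr (Pi\<^sub>M I M) (Pi\<^sub>M I M) (\<lambda>x. x)"
    by (intro distr_cong refl) (auto simp: space_PiM PiE_iff extensional_restrict)
  also have "\<dots> = (\<Pi>\<^sub>M i\<in>I. distr (Pi\<^sub>M I M) (M i) (\<lambda>x. x i))"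
    using M by (auto simp: distr_PiM_component intro!: PiM_cong)
  finally have "P.indep_vars M (\<lambda>i x. x i) I" if "I \<noteq> {}"
    by (subst P.indep_vars_iff_distr_eq_PiM') (use that in auto)
  moreover have "P.indep_vars M (\<lambda>i x. x i) I" if "I = {}"
    unfolding P.indep_vars_def2 P.indep_sets_def using that by simp
  ultimately show ?thesis by blast
qed

lemma (in pair_prob_space) prob_le_exceptional:
  assumes B: "B \<in> sets (M1 \<Otimes>\<^sub>M M2)" and A: "A \<in> sets M1" and "0 \<le> b"
    and b: "AE x in M1. x \<notin> A \<longrightarrow> measure M2 (Pair x -` B) \<le> b"
  shows "measure (M1 \<Otimes>\<^sub>M M2) B \<le> measure M1 A + b"
proof -
  have "emeasure (M1 \<Otimes>\<^sub>M M2) B = (\<integral>\<^sup>+x. emeasure M2 (Pair x -` B) \<partial>M1)"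
    using B by (rule M2.emeasure_pair_measure_alt)
  also have "\<dots> \<le> (\<integral>\<^sup>+x. indicator A x + ennreal b \<partial>M1)"
  proof (rule nn_integral_mono_AE)
    show "AE x in M1. emeasure M2 (Pair x -` B) \<le> indicator A x + ennreal b"
      using b
    proof eventually_elim
      case (elim x)
      show ?case
      proof (cases "x \<in> A")
        case True
        have "emeasure M2 (Pair x -` B) \<le> 1" by (rule M2.measure_le_1)
        then show ?thesis using True by (simp add: add_increasing2)
      qed (use elim in \<open>simp add: M2.emeasure_eq_measure ennreal_leI\<close>)
    qed
  qed
  also have "\<dots> = ennreal (measure M1 A + b)"
    using A \<open>0 \<le> b\<close> by (simp add: nn_integral_add M1.prob_space M1.emeasure_eq_measure)
  finally show ?thesis
    using \<open>0 \<le> b\<close> by (simp add: P.emeasure_eq_measure del: ennreal_plus)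
qed

section \<open>Moments of the Erlang distribution\<close>

lemma (in prob_space) erlang_ith_moment_pochhammer:
  assumes "0 < l" "distributed M lborel X (erlang_density k l)"
  shows "expectation (\<lambda>x. X x ^ i) = pochhammer (real k + 1) i / l ^ i"
proof -
  have "fact (k + i) = fact k * pochhammer (real k + 1) i"
    by (induction i) (simp_all add: pochhammer_Suc algebra_simps)
  then show ?thesis using erlang_ith_moment[OF assms, of i] by simp
qed

lemma (in prob_space) erlang_fourth_central_moment:
  assumes l: "0 < l" and X: "distributed M lborel X (erlang_density k l)"
  shows "integrable M (\<lambda>x. (X x - (real k + 1) / l) ^ 4)"
    and "expectation (\<lambda>x. (X x - (real k + 1) / l) ^ 4) = 3 * (real k + 1) * (real k + 3) / l ^ 4"
proof -
  define \<mu> where "\<mu> = (real k + 1) / l"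
  have binomial: "(x - \<mu>) ^ 4 = x ^ 4 - 4 * \<mu> * x ^ 3 + 6 * \<mu>\<^sup>2 * x\<^sup>2 - 4 * \<mu> ^ 3 * x ^ 1 + \<mu> ^ 4"
    for x :: real
    by algebra
  have int: "integrable M (\<lambda>x. X x ^ i)" for i
    using l X by (rule erlang_ith_moment_integrable)
  show "integrable M (\<lambda>x. (X x - (real k + 1) / l) ^ 4)"
    unfolding \<mu>_def[symmetric] binomial using int by (intro Bochner_Integration.integrable_add
        Bochner_Integration.integrable_diff integrable_mult_right integrable_const)
  have "expectation (\<lambda>x. (X x - \<mu>) ^ 4)
      = expectation (\<lambda>x. X x ^ 4) - 4 * \<mu> * expectation (\<lambda>x. X x ^ 3)
      + 6 * \<mu>\<^sup>2 * expectation (\<lambda>x. (X x)\<^sup>2) - 4 * \<mu> ^ 3 * expectation (\<lambda>x. X x ^ 1) + \<mu> ^ 4"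
    unfolding binomial using int[of 1] int[of 2] int[of 3] int[of 4] by (simp add: prob_space)
  also have "\<dots> = 3 * (real k + 1) * (real k + 3) / l ^ 4"
    unfolding erlang_ith_moment_pochhammer[OF l X] \<mu>_def
    using l by (simp add: eval_nat_numeral pochhammer_Suc field_simps)
  finally show "expectation (\<lambda>x. (X x - (real k + 1) / l) ^ 4)
      = 3 * (real k + 1) * (real k + 3) / l ^ 4"
    by (simp add: \<mu>_def)
qed

lemma (in prob_space) prob_erlang_deviation_le:
  assumes l: "0 < l" and X: "distributed M lborel X (erlang_density k l)" and a: "0 < a"
  shows "prob {x\<in>space M. \<bar>X x - (real k + 1) / l\<bar> \<ge> a}
      \<le> 3 * (real k + 1) * (real k + 3) / (l * a) ^ 4"
proof -
  let ?Y = "\<lambda>x. X x - (real k + 1) / l"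
  have [measurable]: "random_variable borel X" using distributed_measurable[OF X] by simp
  have "a \<le> \<bar>y\<bar> \<longleftrightarrow> a\<^sup>2 \<le> \<bar>y\<^sup>2\<bar>" for y
    using abs_le_square_iff[of a y] a by simp
  then have "prob {x\<in>space M. \<bar>?Y x\<bar> \<ge> a} = prob {x\<in>space M. \<bar>(?Y x)\<^sup>2\<bar> \<ge> a\<^sup>2}"
    by simp
  also have "\<dots> \<le> expectation (\<lambda>x. ((?Y x)\<^sup>2)\<^sup>2) / (a\<^sup>2)\<^sup>2"
    using erlang_fourth_central_moment(1)[OF l X] a
    by (intro second_moment_method) (auto simp flip: power_mult)
  also have "\<dots> = 3 * (real k + 1) * (real k + 3) / (l * a) ^ 4"
    using erlang_fourth_central_moment(2)[OF l X] by (simp add: power_mult_distrib flip: power_mult)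
  finally show ?thesis .
qed

section \<open>Convergence in probability\<close>

lemma with_high_probability_mono_AE:
  assumes Q: "with_high_probability M Q" and M: "\<forall>\<^sub>F n in sequentially. prob_space (M n)"
    and meas: "\<forall>\<^sub>F n in sequentially. {\<omega>\<in>space (M n). Q' n \<omega>} \<in> sets (M n)"
    and imp: "\<forall>\<^sub>F n in sequentially. AE \<omega> in M n. Q n \<omega> \<longrightarrow> Q' n \<omega>"
  shows "with_high_probability M Q'"
  unfolding with_high_probability_def
proof (rule tendsto_sandwich)
  show "(\<lambda>n. measure (M n) {\<omega>\<in>space (M n). Q n \<omega>}) \<longlonglongrightarrow> 1"
    using Q by (simp add: with_high_probability_def)
  show "\<forall>\<^sub>F n in sequentially. measure (M n) {\<omega>\<in>space (M n). Q n \<omega>}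
      \<le> measure (M n) {\<omega>\<in>space (M n). Q' n \<omega>}"
    using M meas imp
  proof eventually_elim
    case (elim n)
    interpret prob_space "M n" by fact
    show ?case
      using elim by (intro finite_measure_mono_AE) auto
  qed
  show "\<forall>\<^sub>F n in sequentially. measure (M n) {\<omega>\<in>space (M n). Q' n \<omega>} \<le> 1"
    using M by eventually_elim (rule prob_space.prob_le_1)
qed simp

lemma tendsto_in_probability_imp_with_high_probability:
  assumes X: "tendsto_in_probability M X c" and "0 < \<epsilon>"
    and M: "\<forall>\<^sub>F n in sequentially. prob_space (M n)"
    and meas: "\<forall>\<^sub>F n in sequentially. X n \<in> borel_measurable (M n)"
  shows "with_high_probability M (\<lambda>n \<omega>. \<bar>X n \<omega> - c\<bar> \<le> \<epsilon>)"
proof -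
  have "(\<lambda>n. 1 - measure (M n) {\<omega>\<in>space (M n). \<bar>X n \<omega> - c\<bar> > \<epsilon>}) \<longlonglongrightarrow> 1 - 0"
    using X \<open>0 < \<epsilon>\<close> by (intro tendsto_intros) (simp add: tendsto_in_probability_def)
  moreover have "\<forall>\<^sub>F n in sequentially. 1 - measure (M n) {\<omega>\<in>space (M n). \<bar>X n \<omega> - c\<bar> > \<epsilon>}
      = measure (M n) {\<omega>\<in>space (M n). \<bar>X n \<omega> - c\<bar> \<le> \<epsilon>}"
    using M meas
  proof eventually_elim
    case (elim n)
    interpret prob_space "M n" by fact
    note [measurable] = elim(2)
    have "prob {\<omega>\<in>space (M n). \<not> \<bar>X n \<omega> - c\<bar> > \<epsilon>} = 1 - prob {\<omega>\<in>space (M n). \<bar>X n \<omega> - c\<bar> > \<epsilon>}"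
      by (rule prob_neg) measurable
    then show ?case by (simp add: not_less)
  qed
  ultimately show ?thesis
    unfolding with_high_probability_def by (simp add: filterlim_cong)
qed

section \<open>The joint law of the weights and the attachment points\<close>

declare One_nat_def [simp del]

abbreviation unit_uniform :: "real measure" where
  "unit_uniform \<equiv> uniform_measure lborel {0<..1}"

lemma prob_space_unit_uniform: "prob_space unit_uniform"
  by (rule prob_space_uniform_measure) auto

lemma AE_unit_uniform: "AE u in unit_uniform. u \<in> {0<..1}"
  by (rule AE_uniform_measureI) auto

lemma measure_unit_uniform_Ioc:
  assumes "0 \<le> a" "a \<le> b" "b \<le> 1"
  shows "measure unit_uniform {a<..b} = b - a"
proof -
  have "{0<..1} \<inter> {a<..b} = {a<..b}" using assms by auto
  then show ?thesis using assms by simp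
qed

lemma attach_density_measurable [measurable]: "attach_density r \<in> borel_measurable borel"
  unfolding attach_density_def by measurable

lemma attach_density_square:
  assumes "0 < r" "u \<in> {0<..1}"
  shows "attach_density r (r * u\<^sup>2) * (2 * r * u) = 1"
proof -
  have "0 < r * u\<^sup>2" "r * u\<^sup>2 \<le> r" using assms by (auto simp: power_le_one)
  moreover have "sqrt (r * (r * u\<^sup>2)) = r * u"
    using assms by (simp add: real_sqrt_mult power2_eq_square)
  ultimately show ?thesis using assms by (simp add: attach_density_def)
qed

lemma density_attach_density:
  assumes r: "r > 0"
  shows "density lborel (attach_density r) = distr unit_uniform borel (\<lambda>u. r * u\<^sup>2)"
proof (rule measure_eqI)
  fix B assume "B \<in> sets (density lborel (attach_density r))"
  then have [measurable]: "B \<in> sets borel" by simp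
  have "emeasure (density lborel (attach_density r)) B
      = (\<integral>\<^sup>+x. ennreal (attach_density r x * indicator B x * indicator {r * 0\<^sup>2..r * 1\<^sup>2} x) \<partial>lborel)"
    by (simp add: emeasure_density)
       (intro nn_integral_cong, auto simp: attach_density_def indicator_def)
  also have "\<dots> = (\<integral>\<^sup>+u. ennreal (attach_density r (r * u\<^sup>2) * indicator B (r * u\<^sup>2) * (2 * r * u)
      * indicator {0..1} u) \<partial>lborel)"
  proof (rule nn_integral_substitution)
    show "set_borel_measurable borel {r * 0\<^sup>2..r * 1\<^sup>2} (\<lambda>x. attach_density r x * indicator B x)"
      unfolding set_borel_measurable_def by measurable
  qed (use r in \<open>auto intro!: derivative_eq_intros continuous_intros\<close>)
  also have "\<dots> = (\<integral>\<^sup>+u. indicator ({0<..1} \<inter> {u. r * u\<^sup>2 \<in> B}) u \<partial>lborel)"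
  proof (rule nn_integral_cong)
    fix u :: real
    show "ennreal (attach_density r (r * u\<^sup>2) * indicator B (r * u\<^sup>2) * (2 * r * u)
        * indicator {0..1} u)
      = indicator ({0<..1} \<inter> {u. r * u\<^sup>2 \<in> B}) u"
    proof (cases "u \<in> {0<..1}")
      case True
      have "attach_density r (r * u\<^sup>2) * indicator B (r * u\<^sup>2) * (2 * r * u)
          = indicator B (r * u\<^sup>2) * (attach_density r (r * u\<^sup>2) * (2 * r * u))"
        by (simp only: mult_ac)
      also have "\<dots> = indicator B (r * u\<^sup>2)"
        by (simp only: attach_density_square[OF r True] mult_1_right)
      finally show ?thesis using True by (simp only:) (simp add: indicator_def)
    qed (cases "u = 0", auto simp: indicator_def)
  qed
  also have "\<dots> = emeasure (distr unit_uniform borel (\<lambda>u. r * u\<^sup>2)) B"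
    by (simp add: emeasure_distr vimage_def divide_ennreal_def)
  finally show "emeasure (density lborel (attach_density r)) B
    = emeasure (distr unit_uniform borel (\<lambda>u. r * u\<^sup>2)) B" .
qed simp

lemma partial_W_0 [simp]: "partial_W w 0 \<omega> = 0"
  and partial_W_Suc: "partial_W w (Suc k) \<omega> = partial_W w k \<omega> + w (Suc k) \<omega>"
  by (simp_all add: partial_W_def)

lemma partial_W_strict_mono_on:
  assumes "\<forall>i\<in>{1..K}. 0 < w i \<omega>"
  shows "strict_mono_on {..K} (\<lambda>k. partial_W w k \<omega>)"
proof (rule strict_mono_onI)
  fix j k assume "j \<in> {..K}" "k \<in> {..K}" "j < k"
  then show "partial_W w j \<omega> < partial_W w k \<omega>"
    using assms
    unfolding partial_W_def by (intro sum_strict_mono2[of _ _ k]) (auto intro: less_imp_le)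
qed

lemma partial_W_measurable:
  "(\<And>i. i \<in> {1..k} \<Longrightarrow> w i \<in> borel_measurable M) \<Longrightarrow> partial_W w k \<in> borel_measurable M"
  unfolding partial_W_def[abs_def] by (intro borel_measurable_sum)

lemma ratio_R_measurable:
  assumes "\<And>i. i \<in> {1..N + 1} \<Longrightarrow> w i \<in> borel_measurable M" "k \<le> N + 1"
  shows "ratio_R N w k \<in> borel_measurable M"
  unfolding ratio_R_def[abs_def] using assms
  by (intro borel_measurable_divide partial_W_measurable) auto

abbreviation coord_space :: "nat \<Rightarrow> ((nat \<Rightarrow> real) \<times> (nat \<Rightarrow> real)) measure" where
  "coord_space N \<equiv> Pi\<^sub>M {1..N + 1} (\<lambda>_. borel) \<Otimes>\<^sub>M Pi\<^sub>M {1..N} (\<lambda>_. borel)"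

definition coords :: "nat \<Rightarrow> (nat \<Rightarrow> 'a \<Rightarrow> real) \<Rightarrow> (nat \<Rightarrow> 'a \<Rightarrow> real) \<Rightarrow> 'a \<Rightarrow> (nat \<Rightarrow> real) \<times> (nat \<Rightarrow> real)" where
  "coords N w l \<omega> = (\<lambda>i\<in>{1..N + 1}. w i \<omega>, \<lambda>k\<in>{1..N}. l k \<omega>)"

lemma coords_measurable:
  assumes "\<And>i. i \<in> {1..N + 1} \<Longrightarrow> w i \<in> borel_measurable M"
      "\<And>k. k \<in> {1..N} \<Longrightarrow> l k \<in> borel_measurable M"
  shows "coords N w l \<in> M \<rightarrow>\<^sub>M coord_space N"
  unfolding coords_def[abs_def] using assms by (intro measurable_Pair measurable_restrict)

abbreviation uniforms :: "nat \<Rightarrow> (nat \<Rightarrow> real) measure" where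
  "uniforms N \<equiv> Pi\<^sub>M {1..N} (\<lambda>_. unit_uniform)"

lemma prob_space_uniforms: "prob_space (uniforms N)"
  by (intro prob_space_PiM prob_space_unit_uniform)

lemma AE_uniforms: "AE u in uniforms N. \<forall>k\<in>{1..N}. u k \<in> {0<..1}"
  by (intro AE_finite_allI AE_PiM_component prob_space_unit_uniform AE_unit_uniform) auto

lemma uniforms_component_measurable:
  "k \<in> {1..N} \<Longrightarrow> (\<lambda>u. u k) \<in> borel_measurable (uniforms N)"
  using measurable_component_singleton[of k "{1..N}" "\<lambda>_. unit_uniform"]
  by (simp cong: measurable_cong_sets)

context bollobas_riordan
begin

abbreviation "N \<equiv> m * n"

lemma w_measurable [measurable]: "i \<in> {1..N + 1} \<Longrightarrow> random_variable borel (w i)"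
  using w_exponential[THEN distributed_measurable] by simp

lemma AE_w_pos: "AE \<omega> in M. \<forall>i\<in>{1..N + 1}. 0 < w i \<omega>"
proof (intro AE_finite_allI)
  fix i assume "i \<in> {1..N + 1}"
  show "AE \<omega> in M. 0 < w i \<omega>"
  proof (rule distributed_AE2[THEN iffD2, OF w_exponential[OF \<open>i \<in> _\<close>]])
    show "AE x in lborel. 0 < ennreal (exponential_density 1 x) \<longrightarrow> 0 < x"
      using AE_lborel_singleton[of "0::real"]
      by eventually_elim (auto simp: exponential_density_def split: if_splits)
  qed measurable
qed simp

lemma AE_ratio_R_pos: "AE \<omega> in M. \<forall>k\<in>{1..N}. 0 < ratio_R N w k \<omega>"
  using AE_w_pos
proof eventually_elim
  case (elim \<omega>)
  show ?case
    using strict_mono_onD[OF partial_W_strict_mono_on[where w=w and \<omega>=\<omega>, OF elim], of 0]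
    by (auto simp: ratio_R_def)
qed

abbreviation "U \<equiv> uniforms N"

sublocale MU: pair_prob_space M U
  using prob_space_uniforms
  by (intro pair_prob_space.intro pair_sigma_finite.intro)
     (auto intro: prob_space_imp_sigma_finite prob_space_axioms)

lemma sigma_W_subalgebra: "subalgebra M (sigma_W M N w)"
proof -
  have "(\<lambda>\<omega>. \<lambda>k\<in>{1..N + 1}. partial_W w k \<omega>) \<in> M \<rightarrow>\<^sub>M Pi\<^sub>M {1..N + 1} (\<lambda>_. borel)"
    by (intro measurable_restrict partial_W_measurable w_measurable) auto
  from measurable_sets[OF this] show ?thesis
    unfolding subalgebra_def sigma_W_def sets_vimage_algebra
    by (auto intro!: sets.sigma_sets_subset)
qed

lemma w_measurable_sigma_W:
  assumes "i \<in> {1..N + 1}"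
  shows "w i \<in> borel_measurable (sigma_W M N w)"
proof -
  have W: "(\<lambda>\<omega>. \<lambda>k\<in>{1..N + 1}. partial_W w k \<omega>) \<in> sigma_W M N w \<rightarrow>\<^sub>M Pi\<^sub>M {1..N + 1} (\<lambda>_. borel)"
    unfolding sigma_W_def
    by (intro measurable_vimage_algebra1) (auto simp: space_PiM)
  have partial_W: "partial_W w k \<in> borel_measurable (sigma_W M N w)" if "k \<le> N + 1" for k
  proof (cases "k = 0")
    case False
    then have k: "k \<in> {1..N + 1}" using that by auto
    show ?thesis
      using measurable_compose[OF W measurable_component_singleton[OF k]] k
      by (simp cong: measurable_cong)
  qed (simp add: partial_W_def[abs_def])
  have "w i = (\<lambda>\<omega>. partial_W w i \<omega> - partial_W w (i - 1) \<omega>)"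
    using assms partial_W_Suc[of w "i - 1"] by auto
  moreover have "i \<le> N + 1" "i - 1 \<le> N + 1" using assms by auto
  ultimately show ?thesis by (auto intro!: borel_measurable_diff partial_W)
qed

lemma sets_sigma_W_Collect:
  assumes "A \<in> sets (Pi\<^sub>M {1..N + 1} (\<lambda>_. borel))"
  shows "{\<omega>\<in>space M. (\<lambda>i\<in>{1..N + 1}. w i \<omega>) \<in> A} \<in> sets (sigma_W M N w)"
proof -
  have "(\<lambda>\<omega>. \<lambda>i\<in>{1..N + 1}. w i \<omega>) \<in> sigma_W M N w \<rightarrow>\<^sub>M Pi\<^sub>M {1..N + 1} (\<lambda>_. borel)"
    by (intro measurable_restrict w_measurable_sigma_W)
  from measurable_sets[OF this assms] show ?thesis
    by (simp add: sigma_W_def vimage_def Int_def conj_commute)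
qed

text \<open>On \<open>M \<Otimes>\<^sub>M U\<close> the attachment points \<open>l k\<close> are replaced by \<open>R k * (u k)\<^sup>2\<close> with \<open>u\<close> independent
  of \<open>w\<close>, so that conditioning on \<open>w\<close> becomes Fubini's theorem.\<close>

definition "w_model i z = w i (fst z)"
definition "l_model k z = ratio_R N w k (fst z) * (snd z k)\<^sup>2"

lemma w_model_measurable: "i \<in> {1..N + 1} \<Longrightarrow> w_model i \<in> borel_measurable (M \<Otimes>\<^sub>M U)"
  unfolding w_model_def[abs_def] by measurable

lemma l_model_measurable: "k \<in> {1..N} \<Longrightarrow> l_model k \<in> borel_measurable (M \<Otimes>\<^sub>M U)"
  unfolding l_model_def[abs_def]
  by (intro borel_measurable_times borel_measurable_power measurable_compose[OF measurable_fst]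
      measurable_compose[OF measurable_snd] ratio_R_measurable w_measurable uniforms_component_measurable) auto

lemma prod_attach_density_eq_uniforms:
  assumes "\<forall>k\<in>{1..N}. 0 < ratio_R N w k \<omega>" and B: "\<And>k. k \<in> {1..N} \<Longrightarrow> B k \<in> sets borel"
  shows "(\<Prod>k=1..N. measure (density lborel (attach_density (ratio_R N w k \<omega>))) (B k))
    = measure U {u\<in>space U. \<forall>k\<in>{1..N}. ratio_R N w k \<omega> * (u k)\<^sup>2 \<in> B k}"
proof -
  have "measure (density lborel (attach_density (ratio_R N w k \<omega>))) (B k)
      = measure unit_uniform {u. ratio_R N w k \<omega> * u\<^sup>2 \<in> B k}" if "k \<in> {1..N}" for k
    using that assms by (simp add: density_attach_density measure_distr vimage_def)
  moreover have "{u. ratio_R N w k \<omega> * u\<^sup>2 \<in> B k} \<in> sets borel" if "k \<in> {1..N}" for k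
    using B[OF that] by measurable
  ultimately show ?thesis
    by (subst measure_PiM_Collect_ball)
       (auto intro!: prod.cong prob_space_unit_uniform simp del: measure_uniform_measure)
qed

lemma cond_law_uniforms:
  assumes B: "\<And>k. k \<in> {1..N} \<Longrightarrow> B k \<in> sets borel"
  shows "AE \<omega> in M. real_cond_exp M (sigma_W M N w) (indicator {\<omega>\<in>space M. \<forall>k\<in>{1..N}. l k \<omega> \<in> B k}) \<omega>
    = measure U {u\<in>space U. \<forall>k\<in>{1..N}. l_model k (\<omega>, u) \<in> B k}"
proof -
  have "AE \<omega> in M. real_cond_exp M (sigma_W M N w) (indicator {\<omega>\<in>space M. \<forall>k\<in>{1..N}. l k \<omega> \<in> B k}) \<omega>
      = (\<Prod>k=1..N. measure (density lborel (attach_density (ratio_R N w k \<omega>))) (B k))"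
    using B by (rule cond_law)
  then show ?thesis
    using AE_ratio_R_pos
    by eventually_elim (simp only: prod_attach_density_eq_uniforms[OF _ B] l_model_def fst_conv snd_conv)
qed

lemma emeasure_attachment_rectangle:
  assumes A: "A \<in> sets (sigma_W M N w)" and B: "\<And>k. k \<in> {1..N} \<Longrightarrow> B k \<in> sets borel"
  shows "emeasure M {\<omega>\<in>A. \<forall>k\<in>{1..N}. l k \<omega> \<in> B k}
    = (\<integral>\<^sup>+\<omega>. indicator A \<omega> * emeasure U {u\<in>space U. \<forall>k\<in>{1..N}. l_model k (\<omega>, u) \<in> B k} \<partial>M)"
proof -
  interpret S: finite_measure_subalgebra M "sigma_W M N w"
    by standard (rule sigma_W_subalgebra)
  define attached where "attached = {\<omega>\<in>space M. \<forall>k\<in>{1..N}. l k \<omega> \<in> B k}"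
  let ?cond = "real_cond_exp M (sigma_W M N w) (indicator attached)"
  have [measurable]: "A \<in> sets M" using A sigma_W_subalgebra by (auto simp: subalgebra_def)
  have [measurable]: "attached \<in> sets M"
    unfolding attached_def using B l_measurable by (intro sets.sets_Collect_finite_All) auto
  have cond_eq: "AE \<omega> in M. ?cond \<omega> = measure U {u\<in>space U. \<forall>k\<in>{1..N}. l_model k (\<omega>, u) \<in> B k}"
    unfolding attached_def using B by (rule cond_law_uniforms)
  have attached_int: "integrable M (indicator attached :: 'a \<Rightarrow> real)"
    by (simp add: less_top[symmetric])
  have "{\<omega>\<in>A. \<forall>k\<in>{1..N}. l k \<omega> \<in> B k} = A \<inter> attached"
    using sets.sets_into_space[OF \<open>A \<in> sets M\<close>] by (auto simp: attached_def)
  then have "prob {\<omega>\<in>A. \<forall>k\<in>{1..N}. l k \<omega> \<in> B k} = (\<integral>\<omega>\<in>A. indicator attached \<omega> \<partial>M)"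
    unfolding set_lebesgue_integral_def by (simp flip: indicator_inter_arith)
  also have "\<dots> = (\<integral>\<omega>\<in>A. ?cond \<omega> \<partial>M)"
    using attached_int A by (rule S.real_cond_exp_intA)
  finally have "emeasure M {\<omega>\<in>A. \<forall>k\<in>{1..N}. l k \<omega> \<in> B k} = ennreal (\<integral>\<omega>\<in>A. ?cond \<omega> \<partial>M)"
    by (simp add: emeasure_eq_measure)
  also have "\<dots> = (\<integral>\<^sup>+\<omega>. ennreal (indicator A \<omega> *\<^sub>R ?cond \<omega>) \<partial>M)"
    unfolding set_lebesgue_integral_def
  proof (rule nn_integral_eq_integral[symmetric])
    show "integrable M (\<lambda>\<omega>. indicator A \<omega> *\<^sub>R ?cond \<omega>)"
      using S.real_cond_exp_int(1)[OF attached_int] by (intro integrable_mult_indicator) auto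
    show "AE \<omega> in M. 0 \<le> indicator A \<omega> *\<^sub>R ?cond \<omega>"
      using cond_eq by eventually_elim auto
  qed
  also have "\<dots> = (\<integral>\<^sup>+\<omega>. indicator A \<omega>
      * emeasure U {u\<in>space U. \<forall>k\<in>{1..N}. l_model k (\<omega>, u) \<in> B k} \<partial>M)"
  proof (rule nn_integral_cong_AE)
    show "AE \<omega> in M. ennreal (indicator A \<omega> *\<^sub>R ?cond \<omega>)
        = indicator A \<omega> * emeasure U {u\<in>space U. \<forall>k\<in>{1..N}. l_model k (\<omega>, u) \<in> B k}"
      using cond_eq by eventually_elim (simp add: MU.M2.emeasure_eq_measure indicator_def)
  qed
  finally show ?thesis .
qed

theorem distr_coords_eq_model:
  "distr M (coord_space N) (coords N w l)
    = distr (M \<Otimes>\<^sub>M U) (coord_space N) (coords N w_model l_model)"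
proof (rule measure_eqI_pair_PiM)
  have coords: "coords N w l \<in> M \<rightarrow>\<^sub>M coord_space N"
    by (intro coords_measurable w_measurable l_measurable)
  have coords_model: "coords N w_model l_model \<in> M \<Otimes>\<^sub>M U \<rightarrow>\<^sub>M coord_space N"
    by (intro coords_measurable w_model_measurable l_model_measurable)
  show "finite_measure (distr M (coord_space N) (coords N w l))"
    using coords by (rule finite_measure_distr)
  fix A B assume A: "A \<in> sets (Pi\<^sub>M {1..N + 1} (\<lambda>_. borel :: real measure))"
    and B: "\<And>k. k \<in> {1..N} \<Longrightarrow> B k \<in> sets (borel :: real measure)"
  define A' where "A' = {\<omega>\<in>space M. (\<lambda>i\<in>{1..N + 1}. w i \<omega>) \<in> A}"
  have A'_sets: "A' \<in> sets (sigma_W M N w)"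
    unfolding A'_def using A by (rule sets_sigma_W_Collect)
  have rectangle: "A \<times> Pi\<^sub>E {1..N} B \<in> sets (coord_space N)"
    using A B by (intro pair_measureI sets_PiM_I_finite) auto
  have "coords N w l -` (A \<times> Pi\<^sub>E {1..N} B) \<inter> space M = {\<omega>\<in>A'. \<forall>k\<in>{1..N}. l k \<omega> \<in> B k}"
    by (auto simp: coords_def A'_def Pi_iff)
  then have "emeasure (distr M (coord_space N) (coords N w l)) (A \<times> Pi\<^sub>E {1..N} B)
      = emeasure M {\<omega>\<in>A'. \<forall>k\<in>{1..N}. l k \<omega> \<in> B k}"
    by (simp only: emeasure_distr[OF coords rectangle])
  also have "\<dots> = (\<integral>\<^sup>+\<omega>. indicator A' \<omega>
      * emeasure U {u\<in>space U. \<forall>k\<in>{1..N}. l_model k (\<omega>, u) \<in> B k} \<partial>M)"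
    using A'_sets B by (rule emeasure_attachment_rectangle)
  also have "\<dots> = (\<integral>\<^sup>+\<omega>. emeasure U (Pair \<omega> -` (coords N w_model l_model -` (A \<times> Pi\<^sub>E {1..N} B)
      \<inter> space (M \<Otimes>\<^sub>M U))) \<partial>M)"
  proof (rule nn_integral_cong)
    fix \<omega> assume "\<omega> \<in> space M"
    then have "Pair \<omega> -` (coords N w_model l_model -` (A \<times> Pi\<^sub>E {1..N} B) \<inter> space (M \<Otimes>\<^sub>M U))
      = (if \<omega> \<in> A' then {u\<in>space U. \<forall>k\<in>{1..N}. l_model k (\<omega>, u) \<in> B k} else {})"
      by (auto simp: coords_def A'_def w_model_def space_pair_measure Pi_iff)
    then show "indicator A' \<omega> * emeasure U {u\<in>space U. \<forall>k\<in>{1..N}. l_model k (\<omega>, u) \<in> B k}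
      = emeasure U (Pair \<omega> -` (coords N w_model l_model -` (A \<times> Pi\<^sub>E {1..N} B) \<inter> space (M \<Otimes>\<^sub>M U)))"
      by simp
  qed
  also have "\<dots> = emeasure (distr (M \<Otimes>\<^sub>M U) (coord_space N) (coords N w_model l_model)) (A \<times> Pi\<^sub>E {1..N} B)"
    unfolding emeasure_distr[OF coords_model rectangle]
    using measurable_sets[OF coords_model rectangle]
    by (rule MU.M2.emeasure_pair_measure_alt[symmetric])
  finally show "emeasure (distr M (coord_space N) (coords N w l)) (A \<times> Pi\<^sub>E {1..N} B)
    = emeasure (distr (M \<Otimes>\<^sub>M U) (coord_space N) (coords N w_model l_model)) (A \<times> Pi\<^sub>E {1..N} B)" .
qed simp_all

end

section \<open>The random multigraph\<close>

definition br_graph ::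
    "nat \<Rightarrow> nat \<Rightarrow> (nat \<Rightarrow> 'a \<Rightarrow> real) \<Rightarrow> (nat \<Rightarrow> 'a \<Rightarrow> real) \<Rightarrow> 'a \<Rightarrow> nat \<Rightarrow> nat set" where
  "br_graph m n w l \<omega> = restrict (br_ends m n w l \<omega>) {1..m * n}"

lemma br_parallel_pairs_eq_br_graph:
  "br_parallel_pairs m n w l \<omega> = num_parallel_pairs {1..m * n} (br_graph m n w l \<omega>)"
  by (simp add: br_parallel_pairs_def br_graph_def num_parallel_pairs_restrict)

lemma br_edge_reduction_eq_br_graph:
  "br_edge_reduction m n w l \<omega> = edge_reduction {1..m * n} (br_graph m n w l \<omega>)"
  by (simp add: br_edge_reduction_def br_graph_def edge_reduction_restrict)

lemma ratio_R_cong: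
  assumes "\<And>i. i \<in> {1..N + 1} \<Longrightarrow> w i \<omega> = w' i \<omega>'" "k \<le> N + 1"
  shows "ratio_R N w k \<omega> = ratio_R N w' k \<omega>'"
proof -
  have "partial_W w k \<omega> = partial_W w' k \<omega>'" if "k \<le> N + 1" for k
    unfolding partial_W_def using that assms(1) by (intro sum.cong) auto
  then show ?thesis using assms(2) by (simp add: ratio_R_def)
qed

lemma block_end_le: "i \<le> n \<Longrightarrow> m * i \<le> m * n + (1::nat)"
  using mult_le_mono2[of i n m] by linarith

lemma br_graph_coords:
  "br_graph m n w l \<omega> = br_graph m n (\<lambda>i z. fst z i) (\<lambda>k z. snd z k) (coords (m * n) w l \<omega>)"
proof -
  let ?z = "coords (m * n) w l \<omega>"
  have R: "ratio_R (m * n) (\<lambda>i z. fst z i) k ?z = ratio_R (m * n) w k \<omega>" if "k \<le> m * n + 1" for k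
    using that by (intro ratio_R_cong) (auto simp: coords_def)
  have "vertex_of m n (\<lambda>i z. fst z i) ?z x = vertex_of m n w \<omega> x" for x
    unfolding vertex_of_def using block_end_le R
    by (intro arg_cong[where f=The] ext conj_cong refl) (auto simp del: greaterThanAtMost_iff)
  then show ?thesis
    using R by (auto simp: br_graph_def br_ends_def restrict_def coords_def fun_eq_iff)
qed

lemma measurable_THE_finite:
  assumes "finite I" and [measurable]: "\<And>j. j \<in> I \<Longrightarrow> Measurable.pred M (P j)"
  shows "(\<lambda>x. THE j. j \<in> I \<and> P j x) \<in> M \<rightarrow>\<^sub>M count_space UNIV"
proof -
  have "(\<lambda>x. {j\<in>I. P j x}) \<in> M \<rightarrow>\<^sub>M count_space (Pow I)"
  proof (subst measurable_count_space_eq2)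
    have "(\<lambda>x. {j\<in>I. P j x}) -` {S} \<inter> space M \<in> sets M" if "S \<subseteq> I" for S
    proof -
      have "(\<lambda>x. {j\<in>I. P j x}) -` {S} \<inter> space M = {x\<in>space M. \<forall>j\<in>I. j \<in> S \<longleftrightarrow> P j x}"
        using that by auto
      also have "\<dots> \<in> sets M"
        using assms by (intro sets.sets_Collect_finite_All) measurable
      finally show ?thesis .
    qed
    then show "(\<lambda>x. {j\<in>I. P j x}) \<in> space M \<rightarrow> Pow I \<and>
      (\<forall>S\<in>Pow I. (\<lambda>x. {j\<in>I. P j x}) -` {S} \<inter> space M \<in> sets M)" by auto
  qed (use assms in simp)
  from measurable_compose[OF this, of "\<lambda>S. THE j. j \<in> S" "count_space UNIV"]
  show ?thesis by simp
qed

lemma vertex_of_measurable: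
  assumes w: "\<And>i. i \<in> {1..m * n + 1} \<Longrightarrow> w i \<in> borel_measurable M"
    and [measurable]: "f \<in> borel_measurable M"
  shows "(\<lambda>x. vertex_of m n w x (f x)) \<in> M \<rightarrow>\<^sub>M count_space UNIV"
  unfolding vertex_of_def
proof (rule measurable_THE_finite)
  fix j assume j: "j \<in> {1..n}"
  then have [measurable]: "ratio_R (m * n) w (m * j) \<in> borel_measurable M"
      "ratio_R (m * n) w (m * (j - 1)) \<in> borel_measurable M"
    by (auto intro!: ratio_R_measurable w block_end_le)
  show "Measurable.pred M (\<lambda>x. f x \<in> {ratio_R (m * n) w (m * (j - 1)) x<..ratio_R (m * n) w (m * j) x})"
    unfolding greaterThanAtMost_iff by measurable
qed simp

lemma br_graph_measurable:
  assumes w: "\<And>i. i \<in> {1..m * n + 1} \<Longrightarrow> w i \<in> borel_measurable M"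
    and l: "\<And>k. k \<in> {1..m * n} \<Longrightarrow> l k \<in> borel_measurable M"
  shows "br_graph m n w l \<in> M \<rightarrow>\<^sub>M count_space UNIV"
proof -
  let ?V = "\<lambda>x. \<lambda>k\<in>{1..m * n}. (vertex_of m n w x (ratio_R (m * n) w k x), vertex_of m n w x (l k x))"
  have pair: "(\<lambda>x. (vertex_of m n w x (f x), vertex_of m n w x (g x))) \<in> M \<rightarrow>\<^sub>M count_space UNIV"
    if "f \<in> borel_measurable M" "g \<in> borel_measurable M" for f g
    using that w by (subst UNIV_Times_UNIV[symmetric], subst pair_measure_countable[symmetric])
       (auto intro!: measurable_Pair vertex_of_measurable)
  have "?V \<in> M \<rightarrow>\<^sub>M Pi\<^sub>M {1..m * n} (\<lambda>_. count_space UNIV)"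
    using w l by (intro measurable_restrict pair ratio_R_measurable) auto
  then have "?V \<in> M \<rightarrow>\<^sub>M count_space (\<Pi>\<^sub>E k\<in>{1..m * n}. UNIV)"
    by (simp add: count_space_PiM_finite)
  from measurable_compose[OF this, of
      "\<lambda>v. \<lambda>k\<in>{1..m * n}. {fst (v k), snd (v k)}" "count_space UNIV"]
  have "(\<lambda>x. \<lambda>k\<in>{1..m * n}. {fst (?V x k), snd (?V x k)}) \<in> M \<rightarrow>\<^sub>M count_space UNIV"
    by simp
  also have "(\<lambda>x. \<lambda>k\<in>{1..m * n}. {fst (?V x k), snd (?V x k)}) = br_graph m n w l"
    by (intro ext) (simp add: br_graph_def br_ends_def)
  finally show ?thesis .
qed

context bollobas_riordan
begin

lemma br_graph_random_variable [measurable]: "br_graph m n w l \<in> M \<rightarrow>\<^sub>M count_space UNIV"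
  by (intro br_graph_measurable w_measurable l_measurable)

lemma br_graph_model_measurable [measurable]:
  "br_graph m n w_model l_model \<in> M \<Otimes>\<^sub>M U \<rightarrow>\<^sub>M count_space UNIV"
  by (intro br_graph_measurable w_model_measurable l_model_measurable)

lemma sets_Collect_br_graph: "{\<omega>\<in>space M. Q (br_graph m n w l \<omega>)} \<in> events"
  using measurable_sets[OF br_graph_random_variable, of "{f. Q f}"]
  by (simp add: vimage_def Int_def conj_commute)

lemma sets_Collect_br_graph_model:
  "{z\<in>space (M \<Otimes>\<^sub>M U). Q (br_graph m n w_model l_model z)} \<in> sets (M \<Otimes>\<^sub>M U)"
  using measurable_sets[OF br_graph_model_measurable, of "{f. Q f}"]
  by (simp add: vimage_def Int_def conj_commute)

lemma distr_br_graph_eq_model: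
  "distr M (count_space UNIV) (br_graph m n w l)
    = distr (M \<Otimes>\<^sub>M U) (count_space UNIV) (br_graph m n w_model l_model)"
proof -
  let ?G = "br_graph m n (\<lambda>i z. fst z i) (\<lambda>k z. snd z k)"
  have G: "?G \<in> coord_space N \<rightarrow>\<^sub>M count_space UNIV"
    by (intro br_graph_measurable measurable_compose[OF measurable_fst] measurable_compose[OF measurable_snd]
        measurable_component_singleton)
  have "distr M (count_space UNIV) (\<lambda>\<omega>. ?G (coords N w l \<omega>))
      = distr (distr M (coord_space N) (coords N w l)) (count_space UNIV) ?G"
    by (subst distr_distr[OF G]) (auto simp: comp_def intro!: coords_measurable w_measurable l_measurable)
  also have "\<dots> = distr (M \<Otimes>\<^sub>M U) (count_space UNIV) (\<lambda>z. ?G (coords N w_model l_model z))"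
    unfolding distr_coords_eq_model
    by (subst distr_distr[OF G])
       (auto simp: comp_def intro!: coords_measurable w_model_measurable l_model_measurable)
  finally show ?thesis unfolding br_graph_coords[symmetric] .
qed

lemma prob_br_graph_eq_model:
  "prob {\<omega>\<in>space M. Q (br_graph m n w l \<omega>)}
    = measure (M \<Otimes>\<^sub>M U) {z\<in>space (M \<Otimes>\<^sub>M U). Q (br_graph m n w_model l_model z)}"
  using measure_distr[OF br_graph_random_variable, of "{f. Q f}"]
    measure_distr[OF br_graph_model_measurable, of "{f. Q f}"]
  by (simp add: distr_br_graph_eq_model vimage_def Int_def conj_commute)

lemma AE_br_graph_iff_model:
  "(AE \<omega> in M. Q (br_graph m n w l \<omega>)) \<longleftrightarrow> (AE z in M \<Otimes>\<^sub>M U. Q (br_graph m n w_model l_model z))"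
  using AE_distr_iff[OF br_graph_random_variable, of Q] AE_distr_iff[OF br_graph_model_measurable, of Q]
  unfolding distr_br_graph_eq_model by simp

end

section \<open>Parallel edges within a block\<close>

definition cell :: "(nat \<Rightarrow> 'a::linorder) \<Rightarrow> nat \<Rightarrow> 'a set" where
  "cell a j = {a (j - 1)<..a j}"

lemma cell_unique:
  fixes a :: "nat \<Rightarrow> 'a::linorder"
  assumes "mono_on {..n} a" "x \<in> cell a i" "x \<in> cell a j" "i \<in> {1..n}" "j \<in> {1..n}"
  shows "i = j"
proof -
  have False if "x \<in> cell a i" "x \<in> cell a j" "i < j" "j \<le> n" for i j
  proof -
    have "a i \<le> a (j - 1)" using that by (intro mono_onD[OF assms(1)]) auto
    then show False using that(1,2) by (auto simp: cell_def)
  qed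
  then show ?thesis using assms by (cases i j rule: linorder_cases) auto
qed

lemma UN_cell:
  fixes a :: "nat \<Rightarrow> 'a::linorder"
  assumes "mono_on {..n} a"
  shows "(\<Union>j\<in>{1..n}. cell a j) = {a 0<..a n}"
  using assms
proof (induction n)
  case (Suc n)
  have "mono_on {..n} a" by (rule mono_on_subset[OF Suc.prems]) auto
  then have "(\<Union>j\<in>{1..Suc n}. cell a j) = {a 0<..a n} \<union> {a n<..a (Suc n)}"
    using Suc.IH by (simp add: atLeastAtMostSuc_conv cell_def Un_commute)
  also have "\<dots> = {a 0<..a (Suc n)}"
    using mono_onD[OF Suc.prems, of 0 n] mono_onD[OF Suc.prems, of n "Suc n"]
    by (intro ivl_disj_un_two) auto
  finally show ?case .
qed simp

abbreviation block :: "nat \<Rightarrow> nat \<Rightarrow> nat set" where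
  "block m \<equiv> cell ((*) m)"

lemma block_unique: "k \<in> block m i \<Longrightarrow> k \<in> block m j \<Longrightarrow> 1 \<le> i \<Longrightarrow> 1 \<le> j \<Longrightarrow> i = j"
  by (rule cell_unique[of "max i j" "(*) m"]) (auto simp: mono_on_def)

lemma disjoint_family_on_block: "disjoint_family_on (block m) {1..n}"
  using block_unique[of _ m] by (fastforce simp: disjoint_family_on_def)

lemma UN_block: "(\<Union>i\<in>{1..n}. block m i) = {1..m * n}"
  by (subst UN_cell) (auto simp: mono_on_def)

lemma finite_block [simp]: "finite (block m i)"
  by (simp add: cell_def)

lemma card_block: "1 \<le> i \<Longrightarrow> card (block m i) = m"
  by (simp add: cell_def diff_mult_distrib2[symmetric])

definition block_pairs :: "nat \<Rightarrow> nat \<Rightarrow> (nat \<times> nat) set" where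
  "block_pairs m i = {(k, k'). k \<in> block m i \<and> k' \<in> block m i \<and> k < k'}"

lemma finite_block_pairs [simp]: "finite (block_pairs m i)"
  by (rule finite_subset[of _ "block m i \<times> block m i"]) (auto simp: block_pairs_def)

lemma card_increasing_pairs:
  fixes A :: "'a::linorder set"
  assumes "finite A"
  shows "card {(x, y). x \<in> A \<and> y \<in> A \<and> x < y} = card A choose 2"
proof -
  have "{(x, y). x \<in> A \<and> y \<in> A \<and> x < y} = {(x, y). x \<in> A \<and> y \<in> A \<and> x < y \<and> x \<noteq> y}" by auto
  then have "card {(x, y). x \<in> A \<and> y \<in> A \<and> x < y} = card {{x, y} | x y. x \<in> A \<and> y \<in> A \<and> x \<noteq> y}"
    using card_unordered_pairs_eq_ordered[of "(\<noteq>)" A] by simp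
  also have "{{x, y} | x y. x \<in> A \<and> y \<in> A \<and> x \<noteq> y} = {B. B \<subseteq> A \<and> card B = 2}"
    by (auto simp: card_2_iff)
  finally show ?thesis using n_subsets[OF assms, of 2] by simp
qed

lemma card_block_pairs: "1 \<le> i \<Longrightarrow> card (block_pairs m i) = m choose 2"
  by (simp add: block_pairs_def card_increasing_pairs card_block)

text \<open>The edge \<open>k\<close> attaches to the vertex \<open>j\<close> iff \<open>u k\<close> lies in \<open>slot m W k j\<close>; the normalisation
  \<open>W (m * n + 1)\<close> of the \<open>R k\<close> cancels.\<close>

definition slot :: "nat \<Rightarrow> (nat \<Rightarrow> real) \<Rightarrow> nat \<Rightarrow> nat \<Rightarrow> real set" where
  "slot m W k = cell (\<lambda>j. sqrt (W (m * j) / W k))"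

definition coattached :: "nat \<Rightarrow> (nat \<Rightarrow> real) \<Rightarrow> nat \<Rightarrow> nat \<Rightarrow> nat \<Rightarrow> (nat \<Rightarrow> real) \<Rightarrow> bool" where
  "coattached m W i k k' u \<longleftrightarrow> (\<exists>j\<in>{1..<i}. u k \<in> slot m W k j \<and> u k' \<in> slot m W k' j)"

definition block_count :: "nat \<Rightarrow> (nat \<Rightarrow> real) \<Rightarrow> nat \<Rightarrow> (nat \<Rightarrow> real) \<Rightarrow> nat" where
  "block_count m W i u = card {(k, k')\<in>block_pairs m i. coattached m W i k k' u}"

locale attachment_weights =
  fixes m n :: nat and W :: "nat \<Rightarrow> real"
  assumes m_pos: "1 \<le> m" and W_0: "W 0 = 0" and W_strict_mono: "strict_mono_on {..m * n + 1} W"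
begin

lemma W_less_iff: "j \<le> m * n + 1 \<Longrightarrow> k \<le> m * n + 1 \<Longrightarrow> W j < W k \<longleftrightarrow> j < k"
  using strict_mono_on_less[OF W_strict_mono] by simp

lemma W_le_iff: "j \<le> m * n + 1 \<Longrightarrow> k \<le> m * n + 1 \<Longrightarrow> W j \<le> W k \<longleftrightarrow> j \<le> k"
  using W_less_iff[of k j] by (simp flip: not_less)

lemma W_pos: "0 < k \<Longrightarrow> k \<le> m * n + 1 \<Longrightarrow> 0 < W k"
  using W_less_iff[of 0 k] W_0 by simp

lemma W_nonneg: "k \<le> m * n + 1 \<Longrightarrow> 0 \<le> W k"
  using W_le_iff[of 0 k] W_0 by simp

lemma block_in_range: "i \<in> {1..n} \<Longrightarrow> k \<in> block m i \<Longrightarrow> k \<in> {1..m * n}"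
  using UN_block[of m n] by blast

lemma slot_unique:
  assumes "x \<in> slot m W k i" "x \<in> slot m W k j" "i \<in> {1..n}" "j \<in> {1..n}" "k \<le> m * n + 1"
  shows "i = j"
proof (rule cell_unique)
  show "mono_on {..n} (\<lambda>j. sqrt (W (m * j) / W k))"
    using W_nonneg[of k] assms(5) block_end_le[of _ n m]
    by (intro mono_onI real_sqrt_le_mono divide_right_mono) (auto simp: W_le_iff)
qed (use assms in \<open>auto simp: slot_def\<close>)

lemma slot_exists:
  assumes i: "i \<in> {1..n}" and k: "k \<in> block m i" and x: "x \<in> {0<..1}"
  obtains j where "j \<in> {1..i}" "x \<in> slot m W k j"
proof -
  have k_bounds: "0 < k" "k \<le> m * i" "k \<le> m * n + 1"
    using block_in_range[OF i k] k by (auto simp: cell_def)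
  have block_end: "m * j \<le> m * n + 1" if "j \<le> i" for j using that i by (intro block_end_le) auto
  have "0 < W k" "W k \<le> W (m * i)"
    using k_bounds block_end W_pos by (auto simp: W_le_iff)
  then have "1 \<le> sqrt (W (m * i) / W k)" by simp
  then have "x \<le> sqrt (W (m * i) / W k)" using x order_trans by fastforce
  then have "x \<in> {sqrt (W (m * 0) / W k)<..sqrt (W (m * i) / W k)}" using x W_0 by simp
  also have "\<dots> = (\<Union>j\<in>{1..i}. cell (\<lambda>j. sqrt (W (m * j) / W k)) j)"
    using \<open>0 < W k\<close> block_end
    by (intro UN_cell[symmetric] mono_onI real_sqrt_le_mono divide_right_mono) (auto simp: W_le_iff)
  finally show ?thesis using that by (auto simp: slot_def)
qed

context
  fixes w l :: "nat \<Rightarrow> 'a \<Rightarrow> real" and \<omega> :: 'a and u :: "nat \<Rightarrow> real"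
  assumes partial_W_eq: "\<And>k. partial_W w k \<omega> = W k"
    and u: "\<forall>k\<in>{1..m * n}. u k \<in> {0<..1}"
    and l: "\<And>k. k \<in> {1..m * n} \<Longrightarrow> l k \<omega> = ratio_R (m * n) w k \<omega> * (u k)\<^sup>2"
begin

lemma ratio_R_eq: "ratio_R (m * n) w k \<omega> = W k / W (m * n + 1)"
  by (simp add: ratio_R_def partial_W_eq)

lemma vertex_of_eqI:
  assumes j: "j \<in> {1..n}" and x: "x \<in> cell (\<lambda>j. ratio_R (m * n) w (m * j) \<omega>) j"
  shows "vertex_of m n w \<omega> x = j"
  unfolding vertex_of_def
proof (rule the_equality)
  show "j \<in> {1..n} \<and> x \<in> {ratio_R (m * n) w (m * (j - 1)) \<omega><..ratio_R (m * n) w (m * j) \<omega>}"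
    using assms by (simp add: cell_def)
  have "mono_on {..n} (\<lambda>j. ratio_R (m * n) w (m * j) \<omega>)"
    using W_pos[of "m * n + 1"] block_end_le[of _ n m]
    by (intro mono_onI) (auto simp: ratio_R_eq W_le_iff intro!: divide_right_mono)
  then show "j' = j"
    if "j' \<in> {1..n} \<and> x \<in> {ratio_R (m * n) w (m * (j' - 1)) \<omega><..ratio_R (m * n) w (m * j') \<omega>}" for j'
    using that assms
    by (intro cell_unique[of n "\<lambda>j. ratio_R (m * n) w (m * j) \<omega>"]) (auto simp: cell_def)
qed

lemma vertex_of_ratio_R:
  assumes i: "i \<in> {1..n}" and k: "k \<in> block m i"
  shows "vertex_of m n w \<omega> (ratio_R (m * n) w k \<omega>) = i"
proof (rule vertex_of_eqI[OF i])
  have "m * i \<le> m * n + 1" "m * (i - 1) \<le> m * n + 1" "k \<le> m * n + 1"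
    using i block_in_range[OF i k] by (auto intro!: block_end_le)
  moreover have "m * (i - 1) < k" "k \<le> m * i" using k by (auto simp: cell_def)
  ultimately have "W (m * (i - 1)) < W k" "W k \<le> W (m * i)"
    using W_less_iff W_le_iff by blast+
  then show "ratio_R (m * n) w k \<omega> \<in> cell (\<lambda>j. ratio_R (m * n) w (m * j) \<omega>) i"
    using W_pos[of "m * n + 1"]
    by (simp add: cell_def ratio_R_eq divide_strict_right_mono divide_right_mono)
qed

lemma l_in_cell_iff:
  assumes k: "k \<in> {1..m * n}"
  shows "l k \<omega> \<in> cell (\<lambda>j. ratio_R (m * n) w (m * j) \<omega>) j \<longleftrightarrow> u k \<in> slot m W k j"
proof -
  have pos: "0 < W k" "0 < W (m * n + 1)" "0 < u k" using k u by (auto intro!: W_pos)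
  have "sqrt (a / W k) < u k \<longleftrightarrow> a / W (m * n + 1) < l k \<omega>" for a
  proof -
    have "sqrt (a / W k) < u k \<longleftrightarrow> sqrt (a / W k) < sqrt ((u k)\<^sup>2)" using pos by simp
    also have "\<dots> \<longleftrightarrow> a < W k * (u k)\<^sup>2"
      unfolding real_sqrt_less_iff using pos by (simp add: field_simps)
    also have "\<dots> \<longleftrightarrow> a / W (m * n + 1) < l k \<omega>"
      unfolding l[OF k] ratio_R_eq using pos by (simp add: field_simps)
    finally show ?thesis .
  qed
  then show ?thesis by (auto simp: slot_def cell_def ratio_R_eq simp flip: not_less)
qed

lemma br_ends_block:
  assumes i: "i \<in> {1..n}" and k: "k \<in> block m i"
  obtains j where "j \<in> {1..i}" "br_ends m n w l \<omega> k = {i, j}"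
    "\<forall>a\<in>{1..n}. u k \<in> slot m W k a \<longleftrightarrow> a = j"
proof -
  have k_range: "k \<in> {1..m * n}" using i k by (rule block_in_range)
  then obtain j where j: "j \<in> {1..i}" "u k \<in> slot m W k j" using slot_exists[OF i k] u by blast
  then have j_range: "j \<in> {1..n}" using i by auto
  have "vertex_of m n w \<omega> (l k \<omega>) = j"
    using j_range j(2) l_in_cell_iff[OF k_range] by (intro vertex_of_eqI) auto
  then have "br_ends m n w l \<omega> k = {i, j}"
    by (simp add: br_ends_def vertex_of_ratio_R[OF i k])
  moreover have "u k \<in> slot m W k a \<longleftrightarrow> a = j" if "a \<in> {1..n}" for a
    using slot_unique[of "u k" k a j] that j(2) j_range k_range by auto
  ultimately show ?thesis using j(1) that by blast
qed

lemma parallel_edges_iff: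
  assumes i: "i \<in> {1..n}" and k: "k \<in> block m i" and k': "k' \<in> {1..m * n}"
  shows "parallel_edges (br_ends m n w l \<omega>) k k'
      \<longleftrightarrow> k \<noteq> k' \<and> k' \<in> block m i \<and> coattached m W i k k' u"
proof -
  obtain i' where i': "i' \<in> {1..n}" "k' \<in> block m i'" using k' UN_block[of m n] by blast
  obtain j where j: "j \<in> {1..i}" "br_ends m n w l \<omega> k = {i, j}"
      "\<forall>a\<in>{1..n}. u k \<in> slot m W k a \<longleftrightarrow> a = j"
    using i k by (rule br_ends_block)
  obtain j' where j': "j' \<in> {1..i'}" "br_ends m n w l \<omega> k' = {i', j'}"
      "\<forall>a\<in>{1..n}. u k' \<in> slot m W k' a \<longleftrightarrow> a = j'"
    using i' by (rule br_ends_block)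
  have "k' \<in> block m i \<longleftrightarrow> i = i'"
    using i' i block_unique[of k' m i i'] by auto
  moreover have "card {i, j} = 2 \<and> {i, j} = {i', j'} \<longleftrightarrow> i = i' \<and> j = j' \<and> j < i"
    using j(1) j'(1) by (auto simp: doubleton_eq_iff card_insert_if)
  moreover have "coattached m W i k k' u \<longleftrightarrow> j = j' \<and> j < i"
    using i j(1,3) j'(3) by (auto simp: coattached_def)
  ultimately show ?thesis using j(2) j'(2) by (auto simp: parallel_edges_def)
qed

lemma card_parallel_le:
  assumes k: "k \<in> {1..m * n}"
  shows "card {j\<in>{1..m * n}. j < k \<and> parallel_edges (br_ends m n w l \<omega>) j k} \<le> m"
proof -
  obtain i where i: "i \<in> {1..n}" "k \<in> block m i" using k UN_block[of m n] by blast
  have "{j\<in>{1..m * n}. j < k \<and> parallel_edges (br_ends m n w l \<omega>) j k} \<subseteq> block m i"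
    using parallel_edges_iff[OF i] parallel_edges_commute[of "br_ends m n w l \<omega>" _ k] by auto
  then have "card {j\<in>{1..m * n}. j < k \<and> parallel_edges (br_ends m n w l \<omega>) j k} \<le> card (block m i)"
    by (intro card_mono) auto
  then show ?thesis using i by (simp add: card_block)
qed

lemma br_parallel_pairs_eq_sum: "br_parallel_pairs m n w l \<omega> = (\<Sum>i=1..n. block_count m W i u)"
proof -
  define S where "S i = {(k, k')\<in>block_pairs m i. coattached m W i k k' u}" for i
  have "{(k, k'). k \<in> {1..m * n} \<and> k' \<in> {1..m * n} \<and> k < k'
        \<and> parallel_edges (br_ends m n w l \<omega>) k k'}
      = (\<Union>i\<in>{1..n}. S i)" (is "?A = ?B")
  proof (intro equalityI subsetI; clarify)
    fix k k' assume k: "k \<in> {1..m * n}" "k' \<in> {1..m * n}" "k < k'"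
      "parallel_edges (br_ends m n w l \<omega>) k k'"
    then obtain i where i: "i \<in> {1..n}" "k \<in> block m i" using UN_block[of m n] by blast
    then show "(k, k') \<in> ?B"
      using k parallel_edges_iff[OF i k(2)] by (auto simp: S_def block_pairs_def)
  next
    fix i k k' assume i: "i \<in> {1..n}" and S: "(k, k') \<in> S i"
    then have k: "k \<in> block m i" "k' \<in> block m i" "k < k'" "coattached m W i k k' u"
      by (auto simp: S_def block_pairs_def)
    then show "k \<in> {1..m * n} \<and> k' \<in> {1..m * n} \<and> k < k' \<and> parallel_edges (br_ends m n w l \<omega>) k k'"
      using parallel_edges_iff[OF i k(1) block_in_range[OF i k(2)]] block_in_range[OF i] by auto
  qed
  then have "br_parallel_pairs m n w l \<omega> = card (\<Union>i\<in>{1..n}. S i)"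
    by (simp add: br_parallel_pairs_def num_parallel_pairs_eq_card)
  also have "\<dots> = (\<Sum>i=1..n. card (S i))"
  proof (rule card_UN_disjoint)
    show "\<forall>i\<in>{1..n}. finite (S i)"
      by (auto simp: S_def intro: finite_subset[OF _ finite_block_pairs[of m]])
    show "\<forall>i\<in>{1..n}. \<forall>j\<in>{1..n}. i \<noteq> j \<longrightarrow> S i \<inter> S j = {}"
      using block_unique[of _ m] by (fastforce simp: S_def block_pairs_def)
  qed simp
  finally show ?thesis by (simp add: S_def block_count_def)
qed

end

end

section \<open>The number of parallel pairs given the weights\<close>

definition increment :: "nat \<Rightarrow> (nat \<Rightarrow> real) \<Rightarrow> nat \<Rightarrow> real" where
  "increment m W j = W (m * j) - W (m * (j - 1))"

definition root_gap :: "nat \<Rightarrow> (nat \<Rightarrow> real) \<Rightarrow> nat \<Rightarrow> real" where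
  "root_gap m W j = sqrt (W (m * j)) - sqrt (W (m * (j - 1)))"

definition mean_count :: "nat \<Rightarrow> (nat \<Rightarrow> real) \<Rightarrow> nat \<Rightarrow> real" where
  "mean_count m W i =
     (\<Sum>(k, k')\<in>block_pairs m i. \<Sum>j\<in>{1..<i}. (root_gap m W j)\<^sup>2 / (sqrt (W k) * sqrt (W k')))"

lemma slot_measurable [measurable]: "slot m W k j \<in> sets borel"
  by (simp add: slot_def cell_def)

lemma coattached_measurable:
  assumes "k \<in> K" "k' \<in> K"
  shows "Measurable.pred (Pi\<^sub>M K (\<lambda>_. borel)) (coattached m W i k k')"
proof -
  have [measurable]: "(\<lambda>u. u k) \<in> borel_measurable (Pi\<^sub>M K (\<lambda>_. borel :: real measure))"
    "(\<lambda>u. u k') \<in> borel_measurable (Pi\<^sub>M K (\<lambda>_. borel :: real measure))"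
    using assms by (auto intro: measurable_component_singleton)
  show ?thesis unfolding coattached_def[abs_def] by measurable
qed

lemma block_count_eq_sum:
  "real (block_count m W i u) = (\<Sum>(k, k')\<in>block_pairs m i. indicator {u. coattached m W i k k' u} u)"
proof -
  have "{(k, k') \<in> block_pairs m i. coattached m W i k k' u}
      = block_pairs m i \<inter> {p. coattached m W i (fst p) (snd p) u}" by auto
  then show ?thesis by (simp add: block_count_def indicator_def sum.If_cases case_prod_beta)
qed

lemma block_count_measurable:
  assumes "block m i \<subseteq> K"
  shows "(\<lambda>u. real (block_count m W i u)) \<in> borel_measurable (Pi\<^sub>M K (\<lambda>_. borel))"
  unfolding block_count_eq_sum
proof (intro borel_measurable_sum, clarify)
  fix k k' assume "(k, k') \<in> block_pairs m i"
  then have "Measurable.pred (Pi\<^sub>M K (\<lambda>_. borel)) (coattached m W i k k')"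
    using assms by (intro coattached_measurable) (auto simp: block_pairs_def)
  then show "(\<lambda>u. indicator {u. coattached m W i k k' u} u :: real)
      \<in> borel_measurable (Pi\<^sub>M K (\<lambda>_. borel))"
    by (simp add: indicator_def)
qed

lemma block_count_restrict: "block_count m W i (restrict u (block m i)) = block_count m W i u"
proof -
  have "coattached m W i k k' (restrict u (block m i)) \<longleftrightarrow> coattached m W i k k' u"
    if "(k, k') \<in> block_pairs m i" for k k'
    using that by (auto simp: coattached_def block_pairs_def)
  then show ?thesis unfolding block_count_def by (intro arg_cong[where f=card]) auto
qed

lemma block_count_le: "1 \<le> i \<Longrightarrow> block_count m W i u \<le> m choose 2"
  unfolding block_count_def card_block_pairs[symmetric] by (intro card_mono) auto

lemma sets_uniforms [measurable_cong]: "sets (uniforms N) = sets (Pi\<^sub>M {1..N} (\<lambda>_. borel))"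
  by (intro sets_PiM_cong) simp_all

lemma measure_uniforms_two_coordinates:
  assumes k: "k \<in> {1..N}" "k' \<in> {1..N}" "k \<noteq> k'" and A: "A \<in> sets borel" and B: "B \<in> sets borel"
  shows "measure (uniforms N) {u\<in>space (uniforms N). u k \<in> A \<and> u k' \<in> B}
    = measure unit_uniform A * measure unit_uniform B"
proof -
  interpret unit_uniform: prob_space unit_uniform by (rule prob_space_unit_uniform)
  define C where "C i = (if i = k then A else if i = k' then B else UNIV)" for i
  have "{u\<in>space (uniforms N). u k \<in> A \<and> u k' \<in> B} = {u\<in>space (uniforms N). \<forall>i\<in>{1..N}. u i \<in> C i}"
    using k by (auto simp: C_def)
  also have "measure (uniforms N) \<dots> = (\<Prod>i\<in>{1..N}. measure unit_uniform {x\<in>space unit_uniform. x \<in> C i})"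
    using A B by (intro measure_PiM_Collect_ball prob_space_unit_uniform) (auto simp: C_def)
  also have "\<dots> = (\<Prod>i\<in>{k, k'}. measure unit_uniform (C i))"
    using k unit_uniform.prob_space
    by (intro prod.mono_neutral_cong_right) (auto simp: C_def simp del: measure_uniform_measure)
  finally show ?thesis using k by (simp add: C_def del: measure_uniform_measure)
qed

context attachment_weights
begin

sublocale U: prob_space "uniforms (m * n)"
  by (rule prob_space_uniforms)

lemma W_block_mono: "j \<le> k \<Longrightarrow> k \<le> n \<Longrightarrow> W (m * j) \<le> W (m * k)"
  using block_end_le[of _ n m] by (simp add: W_le_iff)

lemma W_block_nonneg: "k \<le> n \<Longrightarrow> 0 \<le> W (m * k)"
  by (intro W_nonneg block_end_le)

lemma measure_slot:
  assumes i: "i \<in> {1..n}" and k: "k \<in> block m i" and j: "j \<in> {1..<i}"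
  shows "measure unit_uniform (slot m W k j) = root_gap m W j / sqrt (W k)"
proof -
  have "m * j \<le> m * (i - 1)" using j by (intro mult_le_mono2) auto
  also have "\<dots> < k" using k by (simp add: cell_def)
  finally have "m * j \<le> k" "k \<le> m * n + 1" "0 < k"
    using block_in_range[OF i k] by auto
  then have "W (m * j) \<le> W k" "0 < W k" by (auto simp: W_le_iff intro: W_pos)
  moreover have "W (m * (j - 1)) \<le> W (m * j)" "0 \<le> W (m * (j - 1))"
    using i j by (auto intro!: W_block_mono W_block_nonneg)
  ultimately show ?thesis
    unfolding slot_def cell_def root_gap_def
    by (subst measure_unit_uniform_Ioc)
       (auto simp: real_sqrt_divide diff_divide_distrib intro!: divide_right_mono)
qed

lemma prob_coattached:
  assumes i: "i \<in> {1..n}" and pair: "(k, k') \<in> block_pairs m i"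
  shows "U.prob {u\<in>space (uniforms (m * n)). coattached m W i k k' u}
    = (\<Sum>j\<in>{1..<i}. (root_gap m W j)\<^sup>2 / (sqrt (W k) * sqrt (W k')))"
proof -
  let ?U = "uniforms (m * n)"
  have k: "k \<in> block m i" "k' \<in> block m i" "k \<noteq> k'" using pair by (auto simp: block_pairs_def)
  then have range: "k \<in> {1..m * n}" "k' \<in> {1..m * n}" using block_in_range[OF i] by auto
  define S where "S j = {u\<in>space ?U. u k \<in> slot m W k j \<and> u k' \<in> slot m W k' j}" for j
  have [measurable]: "(\<lambda>u. u k) \<in> borel_measurable ?U" "(\<lambda>u. u k') \<in> borel_measurable ?U"
    using range by (auto intro: uniforms_component_measurable)
  have "{u\<in>space ?U. coattached m W i k k' u} = (\<Union>j\<in>{1..<i}. S j)"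
    by (auto simp: coattached_def S_def)
  moreover have "U.prob (\<Union>j\<in>{1..<i}. S j) = (\<Sum>j\<in>{1..<i}. U.prob (S j))"
  proof (rule U.finite_measure_finite_Union)
    show "S ` {1..<i} \<subseteq> U.events" unfolding S_def by auto
    show "disjoint_family_on S {1..<i}"
      using slot_unique[where k=k] i range(1)
      by (force simp: disjoint_family_on_def S_def)
  qed simp
  moreover have "U.prob (S j) = (root_gap m W j)\<^sup>2 / (sqrt (W k) * sqrt (W k'))"
    if "j \<in> {1..<i}" for j
    unfolding S_def using range k(3)
    by (subst measure_uniforms_two_coordinates)
       (simp_all add: measure_slot[OF i k(1) that] measure_slot[OF i k(2) that] power2_eq_square
        del: measure_uniform_measure)
  ultimately show ?thesis by simp
qed

lemma block_count_random_variable: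
  assumes "i \<in> {1..n}"
  shows "(\<lambda>u. real (block_count m W i u)) \<in> borel_measurable (uniforms (m * n))"
proof -
  have "block m i \<subseteq> {1..m * n}" using block_in_range[OF assms] by blast
  then show ?thesis
    using block_count_measurable by (simp cong: measurable_cong_sets)
qed

lemma expectation_block_count:
  assumes i: "i \<in> {1..n}"
  shows "U.expectation (\<lambda>u. real (block_count m W i u)) = mean_count m W i"
proof -
  let ?U = "uniforms (m * n)"
  have events: "{u\<in>space ?U. coattached m W i k k' u} \<in> U.events"
    if "(k, k') \<in> block_pairs m i" for k k'
  proof -
    have "Measurable.pred ?U (coattached m W i k k')"
      using coattached_measurable[of k "{1..m * n}" k' m W i] that block_in_range[OF i]
      by (simp add: block_pairs_def cong: measurable_cong_sets)
    then show ?thesis by measurable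
  qed
  have "U.expectation (\<lambda>u. real (block_count m W i u))
      = U.expectation (\<lambda>u. \<Sum>(k, k')\<in>block_pairs m i. indicator {u\<in>space ?U. coattached m W i k k' u} u)"
    unfolding block_count_eq_sum
    by (intro Bochner_Integration.integral_cong sum.cong refl) (auto simp: indicator_def)
  also have "\<dots> = (\<Sum>(k, k')\<in>block_pairs m i. U.prob {u\<in>space ?U. coattached m W i k k' u})"
    using events
    by (subst Bochner_Integration.integral_sum) (auto simp: case_prod_beta less_top[symmetric])
  also have "\<dots> = mean_count m W i"
    unfolding mean_count_def using prob_coattached[OF i] by (intro sum.cong) auto
  finally show ?thesis .
qed

lemma mean_count_le_choose:
  assumes i: "i \<in> {1..n}"
  shows "mean_count m W i \<le> real (m choose 2)"
proof -
  have "U.expectation (\<lambda>u. real (block_count m W i u)) \<le> real (m choose 2)"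
    using block_count_le[of i m W] block_count_random_variable[OF i] i
    by (intro U.integral_le_const U.integrable_const_bound[where B="real (m choose 2)"]) auto
  then show ?thesis by (simp add: expectation_block_count[OF i])
qed

lemma indep_block_count:
  "U.indep_vars (\<lambda>_. borel) (\<lambda>i u. real (block_count m W i u)) {1..n}"
proof -
  have "U.indep_vars (\<lambda>_. unit_uniform) (\<lambda>k u. u k) {1..m * n}"
    by (intro indep_vars_PiM_coordinates prob_space_unit_uniform)
  then have "U.indep_vars (\<lambda>_. borel) (\<lambda>k u. u k) {1..m * n}"
    by (rule U.indep_vars_compose2) (simp add: measurable_ident_sets)
  then have "U.indep_vars (\<lambda>i. Pi\<^sub>M (block m i) (\<lambda>_. borel)) (\<lambda>i u. restrict u (block m i)) {1..n}"
    using disjoint_family_on_block block_in_range by (intro U.indep_vars_restrict) auto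
  then have "U.indep_vars (\<lambda>_. borel) (\<lambda>i u. real (block_count m W i (restrict u (block m i)))) {1..n}"
    by (rule U.indep_vars_compose2) (rule block_count_measurable, simp)
  then show ?thesis by (simp add: block_count_restrict)
qed

lemma block_count_deviation:
  assumes "a > 0"
  shows "U.prob {u\<in>space (uniforms (m * n)). \<bar>(\<Sum>i=1..n. real (block_count m W i u))
      - (\<Sum>i=1..n. mean_count m W i)\<bar> \<ge> a}
    \<le> real (m choose 2) * (\<Sum>i=1..n. mean_count m W i) / a\<^sup>2"
  using U.prob_sum_bounded_deviation_le[OF _ indep_block_count _ _ assms, of "real (m choose 2)"]
    block_count_le[of _ m W] expectation_block_count by simp

end

section \<open>Estimates of the conditional mean\<close>

lemma sqrt_diff_squared_le:
  fixes x y :: real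
  assumes "0 \<le> y" "y \<le> x"
  shows "(sqrt x - sqrt y)\<^sup>2 \<le> x - y"
proof -
  have "y = sqrt y * sqrt y" using assms by simp
  also have "\<dots> \<le> sqrt x * sqrt y" using assms by (intro mult_right_mono) auto
  finally show ?thesis using assms by (simp add: power2_diff)
qed

lemma sqrt_diff_squared_bounds:
  fixes x y b B :: real
  assumes "0 < b" "b \<le> y" "y \<le> x" "x \<le> B"
  shows "(x - y)\<^sup>2 / (4 * B) \<le> (sqrt x - sqrt y)\<^sup>2" "(sqrt x - sqrt y)\<^sup>2 \<le> (x - y)\<^sup>2 / (4 * b)"
proof -
  have pos: "0 < x" "0 < y" "0 < B" using assms by auto
  then have "x - y = (sqrt x - sqrt y) * (sqrt x + sqrt y)"
    by (simp add: algebra_simps)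
  then have square_diff: "(x - y)\<^sup>2 = (sqrt x - sqrt y)\<^sup>2 * (sqrt x + sqrt y)\<^sup>2"
    by (metis power_mult_distrib)
  have "(sqrt x + sqrt y)\<^sup>2 \<le> (2 * sqrt B)\<^sup>2"
    using assms pos
    by (intro power_mono) (auto intro!: add_mono[of _ "sqrt B" _ "sqrt B", simplified])
  then have upper: "(sqrt x + sqrt y)\<^sup>2 \<le> 4 * B" using pos by (simp add: power_mult_distrib)
  have "(2 * sqrt b)\<^sup>2 \<le> (sqrt x + sqrt y)\<^sup>2"
    using assms by (intro power_mono) (auto intro!: add_mono[of "sqrt b" _ "sqrt b", simplified])
  then have lower: "4 * b \<le> (sqrt x + sqrt y)\<^sup>2" using assms by (simp add: power_mult_distrib)
  show "(x - y)\<^sup>2 / (4 * B) \<le> (sqrt x - sqrt y)\<^sup>2"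
    using mult_left_mono[OF upper, of "(sqrt x - sqrt y)\<^sup>2"] pos
    by (simp add: square_diff divide_le_eq)
  show "(sqrt x - sqrt y)\<^sup>2 \<le> (x - y)\<^sup>2 / (4 * b)"
    using mult_left_mono[OF lower, of "(sqrt x - sqrt y)\<^sup>2"] assms
    by (simp add: square_diff le_divide_eq)
qed

lemma mean_count_eq_prod:
  "mean_count m W i
    = (\<Sum>(k, k')\<in>block_pairs m i. 1 / (sqrt (W k) * sqrt (W k'))) * (\<Sum>j\<in>{1..<i}. (root_gap m W j)\<^sup>2)"
  unfolding mean_count_def sum_distrib_right
  by (intro sum.cong refl) (simp add: case_prod_beta sum_divide_distrib)

lemma (in attachment_weights) mean_count_nonneg:
  assumes i: "i \<in> {1..n}"
  shows "0 \<le> mean_count m W i"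
proof -
  have "0 \<le> W k" if "k \<in> block m i" for k
    using block_in_range[OF i that] by (intro W_nonneg) auto
  then show ?thesis
    unfolding mean_count_def
    by (auto simp: block_pairs_def intro!: sum_nonneg divide_nonneg_nonneg mult_nonneg_nonneg)
qed

definition harmonic_pair_sum :: "nat \<Rightarrow> nat \<Rightarrow> (nat \<Rightarrow> real) \<Rightarrow> real" where
  "harmonic_pair_sum a n f = (\<Sum>i\<in>{a<..n}. \<Sum>j\<in>{a<..<i}. f j / (real i * real j))"

text \<open>For \<open>W k\<close> close to \<open>k\<close>, each of the \<open>m choose 2\<close> pairs of edges in block \<open>i\<close> attaches to the
  vertex \<open>j\<close> with probability close to \<open>(increment m W j / (2 * m))\<^sup>2 / (i * j)\<close>.\<close>

definition mean_coefficient :: "nat \<Rightarrow> real" where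
  "mean_coefficient m = real (m choose 2) / (2 * real m)\<^sup>2"

lemma mean_coefficient_nonneg: "0 \<le> mean_coefficient m"
  by (simp add: mean_coefficient_def)

locale near_linear_weights = attachment_weights +
  fixes \<delta> :: real and a :: nat
  assumes \<delta>: "0 < \<delta>" "\<delta> < 1" and a_ge: "1 / \<delta> \<le> real a" and a_le: "a \<le> n"
    and near_linear: "\<And>i. i \<in> {a..n} \<Longrightarrow> \<bar>W (m * i) - real (m * i)\<bar> \<le> \<delta> * real (m * i)"
begin

lemma W_block_end_le: "i \<in> {a..n} \<Longrightarrow> W (m * i) \<le> (1 + \<delta>) * (real m * real i)"
  using near_linear[of i] by (auto simp: abs_le_iff algebra_simps)

lemma W_block_start_ge:
  assumes i: "i \<in> {a<..n}"
  shows "(1 - \<delta>)\<^sup>2 * (real m * real i) \<le> W (m * (i - 1))"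
proof -
  have "1 / \<delta> \<le> real i" using a_ge i by auto
  then have "(1 - \<delta>) * real i \<le> real (i - 1)"
    using \<delta> i by (simp add: field_simps of_nat_diff)
  then have "(1 - \<delta>) * (real m * ((1 - \<delta>) * real i)) \<le> (1 - \<delta>) * (real m * real (i - 1))"
    using \<delta> by (intro mult_left_mono) auto
  also have "\<dots> \<le> W (m * (i - 1))"
  proof -
    have "i - 1 \<in> {a..n}" using i by auto
    from near_linear[OF this] show ?thesis by (simp add: abs_le_iff left_diff_distrib)
  qed
  finally show ?thesis by (simp add: power2_eq_square mult_ac)
qed

lemma W_block_bounds:
  assumes i: "i \<in> {a<..n}" and k: "k \<in> block m i"
  shows "(1 - \<delta>)\<^sup>2 * (real m * real i) \<le> W k" "W k \<le> (1 + \<delta>) * (real m * real i)"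
proof -
  have "m * (i - 1) \<le> m * n + 1" "m * i \<le> m * n + 1" "k \<le> m * n + 1"
    using i block_in_range[OF _ k] by (auto intro!: block_end_le)
  then have "W (m * (i - 1)) \<le> W k" "W k \<le> W (m * i)"
    using k by (auto simp: W_le_iff cell_def)
  then show "(1 - \<delta>)\<^sup>2 * (real m * real i) \<le> W k" "W k \<le> (1 + \<delta>) * (real m * real i)"
    using W_block_start_ge[OF i] W_block_end_le[of i] i by auto
qed

lemma sum_inverse_roots_bounds:
  assumes i: "i \<in> {a<..n}"
  shows "real (m choose 2) / ((1 + \<delta>) * (real m * real i))
      \<le> (\<Sum>(k, k')\<in>block_pairs m i. 1 / (sqrt (W k) * sqrt (W k')))"
    and "(\<Sum>(k, k')\<in>block_pairs m i. 1 / (sqrt (W k) * sqrt (W k')))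
      \<le> real (m choose 2) / ((1 - \<delta>)\<^sup>2 * (real m * real i))"
proof -
  define b where "b = (1 - \<delta>)\<^sup>2 * (real m * real i)"
  define B where "B = (1 + \<delta>) * (real m * real i)"
  have pos: "0 < b" "0 < B" using \<delta> m_pos i by (auto simp: b_def B_def)
  have "1 / B \<le> 1 / (sqrt (W k) * sqrt (W k')) \<and> 1 / (sqrt (W k) * sqrt (W k')) \<le> 1 / b"
    if "(k, k') \<in> block_pairs m i" for k k'
  proof -
    have W: "b \<le> W k" "W k \<le> B" "b \<le> W k'" "W k' \<le> B"
      using that W_block_bounds[OF i] by (auto simp: block_pairs_def b_def B_def)
    define s where "s = sqrt (W k) * sqrt (W k')"
    have "sqrt b * sqrt b \<le> s" "s \<le> sqrt B * sqrt B"
      unfolding s_def using W pos by (intro mult_mono; simp)+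
    then have "b \<le> s" "s \<le> B" using pos by simp_all
    then show ?thesis unfolding s_def[symmetric] using pos by (simp add: frac_le)
  qed
  then have "real (card (block_pairs m i)) * (1 / B)
      \<le> (\<Sum>(k, k')\<in>block_pairs m i. 1 / (sqrt (W k) * sqrt (W k')))"
    "(\<Sum>(k, k')\<in>block_pairs m i. 1 / (sqrt (W k) * sqrt (W k')))
      \<le> real (card (block_pairs m i)) * (1 / b)"
    by (intro sum_bounded_below sum_bounded_above; auto)+
  moreover have "card (block_pairs m i) = m choose 2" using i by (intro card_block_pairs) auto
  ultimately show "real (m choose 2) / B
      \<le> (\<Sum>(k, k')\<in>block_pairs m i. 1 / (sqrt (W k) * sqrt (W k')))"
    "(\<Sum>(k, k')\<in>block_pairs m i. 1 / (sqrt (W k) * sqrt (W k'))) \<le> real (m choose 2) / b"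
    by simp_all
qed

lemma root_gap_squared_bounds:
  assumes j: "j \<in> {a<..n}"
  shows "(increment m W j)\<^sup>2 / (4 * ((1 + \<delta>) * (real m * real j))) \<le> (root_gap m W j)\<^sup>2"
    and "(root_gap m W j)\<^sup>2 \<le> (increment m W j)\<^sup>2 / (4 * ((1 - \<delta>)\<^sup>2 * (real m * real j)))"
  unfolding increment_def root_gap_def
  using sqrt_diff_squared_bounds[OF _ W_block_start_ge[OF j] W_block_mono W_block_end_le] j \<delta> m_pos
  by auto

lemma sum_root_gap_squared_le: "(\<Sum>j=1..a. (root_gap m W j)\<^sup>2) \<le> (1 + \<delta>) * (real m * real a)"
proof -
  have "(\<Sum>j=1..a. (root_gap m W j)\<^sup>2) \<le> (\<Sum>j=1..a. W (m * j) - W (m * (j - 1)))"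
    unfolding root_gap_def using a_le
    by (intro sum_mono sqrt_diff_squared_le W_block_mono W_block_nonneg) auto
  also have "\<dots> = W (m * a)"
    using sum_telescope''[of 0 a "\<lambda>j. W (m * j)"] by (simp add: W_0 One_nat_def)
  also have "\<dots> \<le> (1 + \<delta>) * (real m * real a)" using a_le by (intro W_block_end_le) auto
  finally show ?thesis .
qed

lemma mean_count_ge_increments:
  assumes i: "i \<in> {a<..n}"
  shows "mean_coefficient m / (1 + \<delta>)\<^sup>2 * (\<Sum>j\<in>{a<..<i}. (increment m W j)\<^sup>2 / (real i * real j))
      \<le> mean_count m W i"
proof -
  have "mean_coefficient m / (1 + \<delta>)\<^sup>2 * (\<Sum>j\<in>{a<..<i}. (increment m W j)\<^sup>2 / (real i * real j))
      = real (m choose 2) / ((1 + \<delta>) * (real m * real i))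
        * (\<Sum>j\<in>{a<..<i}. (increment m W j)\<^sup>2 / (4 * ((1 + \<delta>) * (real m * real j))))"
    unfolding sum_distrib_left
    by (intro sum.cong refl) (simp add: mean_coefficient_def power2_eq_square)
  also have "\<dots> \<le> real (m choose 2) / ((1 + \<delta>) * (real m * real i))
      * (\<Sum>j\<in>{1..<i}. (root_gap m W j)\<^sup>2)"
  proof (rule mult_left_mono)
    have "(\<Sum>j\<in>{a<..<i}. (increment m W j)\<^sup>2 / (4 * ((1 + \<delta>) * (real m * real j))))
        \<le> (\<Sum>j\<in>{a<..<i}. (root_gap m W j)\<^sup>2)"
      using i root_gap_squared_bounds(1) by (intro sum_mono) auto
    also have "\<dots> \<le> (\<Sum>j\<in>{1..<i}. (root_gap m W j)\<^sup>2)"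
      by (intro sum_mono2) auto
    finally show "(\<Sum>j\<in>{a<..<i}. (increment m W j)\<^sup>2 / (4 * ((1 + \<delta>) * (real m * real j))))
      \<le> (\<Sum>j\<in>{1..<i}. (root_gap m W j)\<^sup>2)" .
  qed (use \<delta> in auto)
  also have "\<dots> \<le> mean_count m W i"
    unfolding mean_count_eq_prod using sum_inverse_roots_bounds(1)[OF i]
    by (intro mult_right_mono sum_nonneg) auto
  finally show ?thesis .
qed

lemma mean_count_le_increments:
  assumes i: "i \<in> {a<..n}"
  shows "mean_count m W i \<le> real (m choose 2) * ((1 + \<delta>) / (1 - \<delta>)\<^sup>2 * real a) / real i
    + mean_coefficient m / (1 - \<delta>) ^ 4 * (\<Sum>j\<in>{a<..<i}. (increment m W j)\<^sup>2 / (real i * real j))"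
proof -
  define q where "q = real (m choose 2) / ((1 - \<delta>)\<^sup>2 * (real m * real i))"
  have "{1..<i} = {1..a} \<union> {a<..<i}" using i by auto
  then have "(\<Sum>j\<in>{1..<i}. (root_gap m W j)\<^sup>2)
      = (\<Sum>j=1..a. (root_gap m W j)\<^sup>2) + (\<Sum>j\<in>{a<..<i}. (root_gap m W j)\<^sup>2)"
    by (simp only:) (rule sum.union_disjoint, auto)
  also have "\<dots> \<le> (1 + \<delta>) * (real m * real a)
      + (\<Sum>j\<in>{a<..<i}. (increment m W j)\<^sup>2 / (4 * ((1 - \<delta>)\<^sup>2 * (real m * real j))))"
    using i root_gap_squared_bounds(2) by (intro add_mono sum_root_gap_squared_le sum_mono) auto
  finally have "mean_count m W i \<le> q * ((1 + \<delta>) * (real m * real a)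
      + (\<Sum>j\<in>{a<..<i}. (increment m W j)\<^sup>2 / (4 * ((1 - \<delta>)\<^sup>2 * (real m * real j)))))"
    unfolding mean_count_eq_prod q_def using sum_inverse_roots_bounds(2)[OF i]
    by (intro mult_mono sum_nonneg) auto
  also have "\<dots> = real (m choose 2) * ((1 + \<delta>) / (1 - \<delta>)\<^sup>2 * real a) / real i
    + mean_coefficient m / (1 - \<delta>) ^ 4 * (\<Sum>j\<in>{a<..<i}. (increment m W j)\<^sup>2 / (real i * real j))"
    unfolding distrib_left sum_distrib_left
  proof (intro arg_cong2[where f="(+)"] sum.cong refl)
    show "q * ((1 + \<delta>) * (real m * real a))
        = real (m choose 2) * ((1 + \<delta>) / (1 - \<delta>)\<^sup>2 * real a) / real i"
      using m_pos by (simp add: q_def)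
    show "q * ((increment m W j)\<^sup>2 / (4 * ((1 - \<delta>)\<^sup>2 * (real m * real j))))
        = mean_coefficient m / (1 - \<delta>) ^ 4 * ((increment m W j)\<^sup>2 / (real i * real j))" for j
      by (simp add: q_def mean_coefficient_def power2_eq_square power4_eq_xxxx)
  qed
  finally show ?thesis .
qed

lemma sum_mean_count_ge:
  "mean_coefficient m / (1 + \<delta>)\<^sup>2 * harmonic_pair_sum a n (\<lambda>j. (increment m W j)\<^sup>2)
    \<le> (\<Sum>i=1..n. mean_count m W i)"
proof -
  have "mean_coefficient m / (1 + \<delta>)\<^sup>2 * harmonic_pair_sum a n (\<lambda>j. (increment m W j)\<^sup>2)
      \<le> (\<Sum>i\<in>{a<..n}. mean_count m W i)"
    unfolding harmonic_pair_sum_def sum_distrib_left[of _ _ "{a<..n}"]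
    by (intro sum_mono mean_count_ge_increments)
  also have "\<dots> \<le> (\<Sum>i=1..n. mean_count m W i)"
    using mean_count_nonneg by (intro sum_mono2) auto
  finally show ?thesis .
qed

lemma sum_mean_count_le:
  "(\<Sum>i=1..n. mean_count m W i)
    \<le> real (m choose 2) * real a * (1 + (1 + \<delta>) / (1 - \<delta>)\<^sup>2 * harm n)
      + mean_coefficient m / (1 - \<delta>) ^ 4 * harmonic_pair_sum a n (\<lambda>j. (increment m W j)\<^sup>2)"
proof -
  let ?e = "real (m choose 2) * ((1 + \<delta>) / (1 - \<delta>)\<^sup>2 * real a)"
  have "{1..n} = {1..a} \<union> {a<..n}" using a_le by auto
  then have "(\<Sum>i=1..n. mean_count m W i)
      = (\<Sum>i=1..a. mean_count m W i) + (\<Sum>i\<in>{a<..n}. mean_count m W i)"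
    by (simp only:) (rule sum.union_disjoint, auto)
  moreover have "(\<Sum>i=1..a. mean_count m W i) \<le> real a * real (m choose 2)"
    using sum_bounded_above[of "{1..a}" "mean_count m W" "real (m choose 2)"] mean_count_le_choose a_le by auto
  moreover have "(\<Sum>i\<in>{a<..n}. mean_count m W i) \<le> (\<Sum>i\<in>{a<..n}. ?e / real i)
      + mean_coefficient m / (1 - \<delta>) ^ 4 * harmonic_pair_sum a n (\<lambda>j. (increment m W j)\<^sup>2)"
    unfolding harmonic_pair_sum_def sum_distrib_left[of _ _ "{a<..n}"] sum.distrib[symmetric]
    by (intro sum_mono mean_count_le_increments)
  moreover have "(\<Sum>i\<in>{a<..n}. ?e / real i) \<le> (\<Sum>i=1..n. ?e / real i)"
    using \<delta> by (intro sum_mono2) auto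
  moreover have "(\<Sum>i=1..n. ?e / real i) = ?e * harm n"
    by (simp add: harm_def sum_distrib_left divide_inverse)
  ultimately show ?thesis by (simp add: algebra_simps)
qed

end

section \<open>Harmonic sums\<close>

lemma sum_inverse_squares_le:
  assumes "1 \<le> a"
  shows "(\<Sum>i=a..n. 1 / (real i)\<^sup>2) \<le> 2 / real a"
proof (cases "a \<le> n")
  case True
  have "(\<Sum>i=a..n. 1 / (real i)\<^sup>2) \<le> 2 / real a - 1 / real n"
    using True
  proof (induction n rule: dec_induct)
    case base
    then show ?case using assms by (simp add: power2_eq_square field_simps)
  next
    case (step n)
    have "0 < real n" using step.hyps assms by simp
    then have "1 / (real n + 1)\<^sup>2 \<le> 1 / (real n * (real n + 1))"
      by (intro divide_left_mono) (auto simp: power2_eq_square)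
    also have "\<dots> = 1 / real n - 1 / real (Suc n)" using \<open>0 < real n\<close> by (simp add: field_simps)
    finally show ?case using step by (simp add: add.commute)
  qed
  moreover have "0 \<le> 1 / real n" by simp
  ultimately show ?thesis by linarith
qed simp

lemma sum_squared_eq_pair_sum:
  fixes f :: "nat \<Rightarrow> 'a::comm_ring_1"
  shows "(\<Sum>i\<in>{a<..n}. f i)\<^sup>2 = 2 * (\<Sum>i\<in>{a<..n}. \<Sum>j\<in>{a<..<i}. f i * f j) + (\<Sum>i\<in>{a<..n}. (f i)\<^sup>2)"
proof (induction n)
  case (Suc n)
  show ?case
  proof (cases "a \<le> n")
    case True
    then have "{a<..Suc n} = insert (Suc n) {a<..n}" "{a<..<Suc n} = {a<..n}" by auto
    then show ?thesis using Suc by (simp add: power2_sum sum_distrib_left algebra_simps)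
  qed simp
qed simp

lemma sum_inverse_eq_harm_diff:
  "a \<le> n \<Longrightarrow> (\<Sum>i\<in>{a<..n}. 1 / real i) = harm n - harm a"
proof (induction n rule: dec_induct)
  case (step n)
  then have "{a<..Suc n} = insert (Suc n) {a<..n}" by auto
  then show ?case using step by (simp add: harm_Suc inverse_eq_divide)
qed simp

lemma ln_real_at_top: "filterlim (\<lambda>n. ln (real n)) at_top sequentially"
  by (rule filterlim_compose[OF ln_at_top filterlim_real_sequentially])

lemma const_div_ln_tendsto: "(\<lambda>n. x / ln (real n)) \<longlonglongrightarrow> 0"
  by (intro tendsto_divide_0[OF tendsto_const] filterlim_at_top_imp_at_infinity ln_real_at_top)

lemma const_div_ln_squared_tendsto: "(\<lambda>n. x / (ln (real n))\<^sup>2) \<longlonglongrightarrow> 0"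
  using tendsto_mult[OF const_div_ln_tendsto[of x] const_div_ln_tendsto[of 1]]
  by (simp add: power2_eq_square)

lemma harm_div_ln_tendsto: "(\<lambda>n. harm n / ln (real n)) \<longlonglongrightarrow> 1"
proof -
  have "(\<lambda>n. (harm n - ln (real n)) / ln (real n)) \<longlonglongrightarrow> 0"
    using tendsto_divide_0[OF euler_mascheroni_LIMSEQ filterlim_at_top_imp_at_infinity[OF ln_real_at_top]] by simp
  then have "(\<lambda>n. 1 + (harm n - ln (real n)) / ln (real n)) \<longlonglongrightarrow> 1 + 0"
    by (intro tendsto_intros)
  moreover have "\<forall>\<^sub>F n in sequentially. 1 + (harm n - ln (real n)) / ln (real n)
      = harm n / ln (real n)"
    using eventually_gt_at_top[of 1] by eventually_elim (simp add: field_simps)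
  ultimately show ?thesis by (simp add: filterlim_cong)
qed

lemma harm_div_ln_squared_tendsto: "(\<lambda>n. harm n / (ln (real n))\<^sup>2) \<longlonglongrightarrow> 0"
  using tendsto_mult[OF harm_div_ln_tendsto const_div_ln_tendsto[of 1]]
  by (simp add: power2_eq_square)

lemma harmonic_pair_sum_div_ln_squared_tendsto:
  "(\<lambda>n. harmonic_pair_sum a n (\<lambda>_. 1) / (ln (real n))\<^sup>2) \<longlonglongrightarrow> 1 / 2"
proof -
  let ?S = "\<lambda>n. \<Sum>i\<in>{a<..n}. 1 / (real i)\<^sup>2"
  have squares_le: "?S n \<le> 2" for n
  proof -
    have "?S n \<le> (\<Sum>i=1..n. 1 / (real i)\<^sup>2)" by (intro sum_mono2) auto
    then show ?thesis using sum_inverse_squares_le[of 1 n] by simp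
  qed
  have squares: "(\<lambda>n. ?S n / (ln (real n))\<^sup>2) \<longlonglongrightarrow> 0"
  proof (rule tendsto_sandwich[OF _ _ tendsto_const const_div_ln_squared_tendsto])
    show "\<forall>\<^sub>F n in sequentially. ?S n / (ln (real n))\<^sup>2 \<le> 2 / (ln (real n))\<^sup>2"
      using squares_le by (intro always_eventually allI divide_right_mono) auto
    show "\<forall>\<^sub>F n in sequentially. 0 \<le> ?S n / (ln (real n))\<^sup>2"
      by (intro always_eventually allI divide_nonneg_nonneg sum_nonneg) auto
  qed
  have lim: "(\<lambda>n. ((harm n / ln (real n) - harm a / ln (real n))\<^sup>2 - ?S n / (ln (real n))\<^sup>2) / 2)
      \<longlonglongrightarrow> ((1 - 0)\<^sup>2 - 0) / 2"
    by (intro tendsto_intros harm_div_ln_tendsto const_div_ln_tendsto squares) auto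
  have "\<forall>\<^sub>F n in sequentially. ((harm n / ln (real n) - harm a / ln (real n))\<^sup>2
      - ?S n / (ln (real n))\<^sup>2) / 2
      = harmonic_pair_sum a n (\<lambda>_. 1) / (ln (real n))\<^sup>2"
    using eventually_ge_at_top[of a]
  proof eventually_elim
    case (elim n)
    have "(harm n - harm a)\<^sup>2 = 2 * harmonic_pair_sum a n (\<lambda>_. 1) + ?S n"
      using sum_squared_eq_pair_sum[of "\<lambda>i. 1 / real i" a n]
      by (simp add: harmonic_pair_sum_def power_one_over sum_inverse_eq_harm_diff[OF elim])
    then show ?case
      by (simp add: power_divide add_divide_distrib flip: diff_divide_distrib)
  qed
  from Lim_transform_eventually[OF lim this] show ?thesis by simp
qed

definition harmonic_weight :: "nat \<Rightarrow> nat \<Rightarrow> real" where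
  "harmonic_weight n j = (\<Sum>i\<in>{j<..n}. 1 / real i) / real j"

lemma harmonic_pair_sum_eq_weighted:
  "harmonic_pair_sum a n f = (\<Sum>j\<in>{a<..n}. harmonic_weight n j * f j)"
proof -
  have "harmonic_pair_sum a n f = (\<Sum>i\<in>{a<..n}. \<Sum>j\<in>{j\<in>{a<..n}. j < i}. f j / (real i * real j))"
    unfolding harmonic_pair_sum_def by (intro sum.cong refl) auto
  also have "\<dots> = (\<Sum>j\<in>{a<..n}. \<Sum>i\<in>{i\<in>{a<..n}. j < i}. f j / (real i * real j))"
    by (rule sum.swap_restrict) auto
  also have "\<dots> = (\<Sum>j\<in>{a<..n}. harmonic_weight n j * f j)"
  proof (intro sum.cong refl)
    fix j assume "j \<in> {a<..n}"
    then have "{i\<in>{a<..n}. j < i} = {j<..n}" by auto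
    then show "(\<Sum>i\<in>{i\<in>{a<..n}. j < i}. f j / (real i * real j)) = harmonic_weight n j * f j"
      by (simp add: harmonic_weight_def sum_distrib_left sum_distrib_right sum_divide_distrib mult.commute)
  qed
  finally show ?thesis .
qed

lemma sum_harmonic_weight_squared_le: "(\<Sum>j\<in>{a<..n}. (harmonic_weight n j)\<^sup>2) \<le> 2 * (harm n)\<^sup>2"
proof -
  have "(\<Sum>j\<in>{a<..n}. (harmonic_weight n j)\<^sup>2) \<le> (\<Sum>j\<in>{a<..n}. (harm n)\<^sup>2 * (1 / (real j)\<^sup>2))"
  proof (rule sum_mono)
    fix j assume "j \<in> {a<..n}"
    have "(\<Sum>i\<in>{j<..n}. 1 / real i) \<le> harm n"
      unfolding harm_def inverse_eq_divide by (intro sum_mono2) auto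
    then have "(\<Sum>i\<in>{j<..n}. 1 / real i)\<^sup>2 \<le> (harm n)\<^sup>2"
      by (intro power_mono sum_nonneg) auto
    then show "(harmonic_weight n j)\<^sup>2 \<le> (harm n)\<^sup>2 * (1 / (real j)\<^sup>2)"
      unfolding harmonic_weight_def power_divide by (simp add: divide_right_mono)
  qed
  also have "\<dots> \<le> (\<Sum>j=1..n. (harm n)\<^sup>2 * (1 / (real j)\<^sup>2))"
    by (intro sum_mono2) auto
  also have "\<dots> \<le> (harm n)\<^sup>2 * 2"
    unfolding sum_distrib_left[symmetric]
    using sum_inverse_squares_le[of 1 n] by (intro mult_left_mono) auto
  finally show ?thesis by simp
qed

section \<open>Concentration of the weights\<close>

lemma increment_partial_W:
  assumes "1 \<le> j"
  shows "increment m (\<lambda>k. partial_W w k \<omega>) j = (\<Sum>k\<in>block m j. w k \<omega>)"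
proof -
  have "{1..b} = {1..a} \<union> {a<..b}" if "a \<le> b" for a b :: nat using that by auto
  then have "{1..m * j} = {1..m * (j - 1)} \<union> block m j" by (simp add: cell_def)
  moreover have "{1..m * (j - 1)} \<inter> block m j = {}" by (auto simp: cell_def)
  ultimately show ?thesis
    by (simp add: increment_def partial_W_def sum.union_disjoint)
qed

context bollobas_riordan
begin

abbreviation "W \<omega> \<equiv> (\<lambda>k. partial_W w k \<omega>)"

lemma partial_W_random_variable: "k \<le> N + 1 \<Longrightarrow> random_variable borel (partial_W w k)"
  by (intro partial_W_measurable w_measurable) auto

lemma partial_W_block_random_variable [measurable]:
  "i \<le> n \<Longrightarrow> random_variable borel (partial_W w (m * i))"
  by (intro partial_W_random_variable block_end_le)

lemma block_subset:
  assumes "i \<in> {1..n}"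
  shows "block m i \<subseteq> {1..N + 1}"
proof -
  have "block m i \<subseteq> (\<Union>i\<in>{1..n}. block m i)" using assms by blast
  also have "\<dots> \<subseteq> {1..N + 1}" unfolding UN_block by auto
  finally show ?thesis .
qed

lemma distributed_sum_w:
  assumes "K \<subseteq> {1..N + 1}" "K \<noteq> {}"
  shows "distributed M lborel (\<lambda>\<omega>. \<Sum>k\<in>K. w k \<omega>) (erlang_density (card K - 1) 1)"
  using assms finite_subset[OF assms(1)]
  by (intro exponential_distributed_sum w_exponential indep_vars_subset[OF w_indep]) auto

lemma partial_W_erlang:
  assumes "k \<in> {1..N + 1}"
  shows "distributed M lborel (partial_W w k) (erlang_density (k - 1) 1)"
proof -
  have "{1..k} \<subseteq> {1..N + 1}" "{1..k} \<noteq> {}" using assms by auto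
  from distributed_sum_w[OF this] show ?thesis by (simp add: partial_W_def[abs_def])
qed

lemma prob_block_end_deviation_le:
  assumes m: "1 \<le> m" and \<delta>: "0 < \<delta>" and i: "i \<in> {1..n}"
  shows "prob {\<omega>\<in>space M. \<bar>partial_W w (m * i) \<omega> - real (m * i)\<bar> \<ge> \<delta> * real (m * i)}
      \<le> 9 / \<delta> ^ 4 * (1 / (real i)\<^sup>2)"
proof -
  define x where "x = real (m * i)"
  have "1 \<le> m * i" using mult_le_mono[OF m, of 1 i] i by simp
  then have block_end: "1 \<le> m * i" "m * i \<in> {1..N + 1}" using i block_end_le[of i n m] by auto
  have x: "1 \<le> x" "real (m * i - 1) = x - 1"
    using of_nat_mono[OF block_end(1), where 'a=real] of_nat_diff[OF block_end(1), where 'a=real]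
    by (simp_all add: x_def)
  have "real i \<le> x" using mult_right_mono[of 1 "real m" "real i"] m by (simp add: x_def)
  have "prob {\<omega>\<in>space M. \<bar>partial_W w (m * i) \<omega> - x\<bar> \<ge> \<delta> * x} \<le> 3 * x * (x + 2) / (\<delta> * x) ^ 4"
    using prob_erlang_deviation_le[OF _ partial_W_erlang[OF block_end(2)], of "\<delta> * x"] \<delta> x
    by (simp add: add.commute)
  also have "\<dots> \<le> 9 * x\<^sup>2 / (\<delta> * x) ^ 4"
    using x by (intro divide_right_mono) (auto simp: power2_eq_square algebra_simps)
  also have "\<dots> = 9 / \<delta> ^ 4 * (1 / x\<^sup>2)"
    using x \<delta> by (simp add: power_mult_distrib field_simps flip: power_add)
  also have "\<dots> \<le> 9 / \<delta> ^ 4 * (1 / (real i)\<^sup>2)"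
    using \<open>real i \<le> x\<close> i x by (intro mult_left_mono divide_left_mono power_mono) auto
  finally show ?thesis by (simp only: x_def)
qed

definition near_linear :: "real \<Rightarrow> nat \<Rightarrow> 'a \<Rightarrow> bool" where
  "near_linear \<delta> a \<omega> \<longleftrightarrow> (\<forall>i\<in>{a..n}. \<bar>partial_W w (m * i) \<omega> - real (m * i)\<bar> < \<delta> * real (m * i))"

lemma near_linear_measurable: "{\<omega>\<in>space M. near_linear \<delta> a \<omega>} \<in> events"
  unfolding near_linear_def by (intro sets.sets_Collect_finite_All) auto

lemma prob_not_near_linear_le:
  assumes m: "1 \<le> m" and \<delta>: "0 < \<delta>" and a: "1 \<le> a"
  shows "prob {\<omega>\<in>space M. \<not> near_linear \<delta> a \<omega>} \<le> 18 / (\<delta> ^ 4 * real a)"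
proof -
  define D where "D i = {\<omega>\<in>space M. \<bar>partial_W w (m * i) \<omega>
      - real (m * i)\<bar> \<ge> \<delta> * real (m * i)}" for i
  have "{\<omega>\<in>space M. \<not> near_linear \<delta> a \<omega>} = (\<Union>i\<in>{a..n}. D i)"
    by (auto simp: near_linear_def D_def not_less)
  also have "prob \<dots> \<le> (\<Sum>i=a..n. prob (D i))"
    unfolding D_def by (intro finite_measure_subadditive_finite) auto
  also have "\<dots> \<le> (\<Sum>i=a..n. 9 / \<delta> ^ 4 * (1 / (real i)\<^sup>2))"
    unfolding D_def using m \<delta> a by (intro sum_mono prob_block_end_deviation_le) auto
  also have "\<dots> \<le> 9 / \<delta> ^ 4 * (2 / real a)"
    unfolding sum_distrib_left[symmetric]
    using \<delta> a by (intro mult_left_mono sum_inverse_squares_le) auto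
  finally show ?thesis by simp
qed

abbreviation "block_increment j \<omega> \<equiv> increment m (W \<omega>) j"

lemma block_increment_erlang:
  assumes "1 \<le> m" "j \<in> {1..n}"
  shows "distributed M lborel (block_increment j) (erlang_density (m - 1) 1)"
proof -
  have "card (block m j) = m" using assms(2) by (simp add: card_block)
  then have "block m j \<noteq> {}" using assms(1) by auto
  then show ?thesis
    using distributed_sum_w[OF block_subset[OF assms(2)]] assms(2) \<open>card _ = m\<close>
    by (simp add: increment_partial_W)
qed

lemma expectation_block_increment_power:
  assumes "1 \<le> m" "j \<in> {1..n}"
  shows "expectation (\<lambda>\<omega>. block_increment j \<omega> ^ i) = pochhammer (real m) i"
  using erlang_ith_moment_pochhammer[OF _ block_increment_erlang[OF assms], of i] assms(1) by simp

lemma indep_block_increments: "indep_vars (\<lambda>_. borel) block_increment {1..n}"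
proof -
  have "indep_vars (\<lambda>_. borel) (\<lambda>j \<omega>. \<Sum>k\<in>block m j. w k \<omega>) {1..n}"
    using w_indep disjoint_family_on_block block_subset by (rule indep_vars_sum_disjoint)
  then show ?thesis
    by (rule indep_vars_cong[THEN iffD1, rotated -1]) (auto simp: increment_partial_W)
qed

definition increment_sum :: "nat \<Rightarrow> 'a \<Rightarrow> real" where
  "increment_sum a \<omega> = harmonic_pair_sum a n (\<lambda>j. (block_increment j \<omega>)\<^sup>2)"

lemma increment_sum_measurable [measurable]: "random_variable borel (increment_sum a)"
  unfolding increment_sum_def[abs_def] harmonic_pair_sum_def increment_def
  by (intro borel_measurable_sum borel_measurable_divide borel_measurable_power borel_measurable_diff
      borel_measurable_const partial_W_block_random_variable) auto

lemma increment_sum_deviation: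
  assumes m: "1 \<le> m" and t: "0 < t"
  shows "prob {\<omega>\<in>space M. \<bar>increment_sum a \<omega>
      - real m * (real m + 1) * harmonic_pair_sum a n (\<lambda>_. 1)\<bar> \<ge> t}
    \<le> 2 * pochhammer (real m) 4 * (harm n)\<^sup>2 / t\<^sup>2"
proof -
  have pochhammer_2: "pochhammer (real m) 2 = real m * (real m + 1)"
    by (simp add: numeral_2_eq_2 pochhammer_Suc)
  define X where "X j \<omega> = harmonic_weight n j * (block_increment j \<omega>)\<^sup>2" for j \<omega>
  have range: "j \<in> {1..n}" if "j \<in> {a<..n}" for j using that by auto
  have square_X: "(X j \<omega>)\<^sup>2 = (harmonic_weight n j)\<^sup>2 * block_increment j \<omega> ^ 4" for j \<omega>
    by (simp add: X_def power_mult_distrib flip: power_mult)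
  have "indep_vars (\<lambda>_. borel) X {a<..n}"
    unfolding X_def
    by (rule indep_vars_compose2[OF indep_vars_subset[OF indep_block_increments]]) (auto dest: range)
  moreover have "integrable M (\<lambda>\<omega>. (X j \<omega>)\<^sup>2)" if "j \<in> {a<..n}" for j
    unfolding square_X
    using erlang_ith_moment_integrable[OF _ block_increment_erlang[OF m range[OF that]]] by simp
  ultimately have "prob {\<omega>\<in>space M. \<bar>(\<Sum>j\<in>{a<..n}. X j \<omega>) - (\<Sum>j\<in>{a<..n}. expectation (X j))\<bar> \<ge> t}
      \<le> (\<Sum>j\<in>{a<..n}. expectation (\<lambda>\<omega>. (X j \<omega>)\<^sup>2)) / t\<^sup>2"
    using t by (intro prob_sum_deviation_le) auto
  also have "(\<Sum>j\<in>{a<..n}. expectation (X j))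
      = real m * (real m + 1) * harmonic_pair_sum a n (\<lambda>_. 1)"
    unfolding harmonic_pair_sum_eq_weighted sum_distrib_left
    by (intro sum.cong refl)
       (simp add: X_def[abs_def] expectation_block_increment_power[OF m range] pochhammer_2)
  also have "(\<Sum>j\<in>{a<..n}. expectation (\<lambda>\<omega>. (X j \<omega>)\<^sup>2))
      = (\<Sum>j\<in>{a<..n}. (harmonic_weight n j)\<^sup>2) * pochhammer (real m) 4"
    unfolding square_X sum_distrib_right
    by (intro sum.cong refl) (simp add: expectation_block_increment_power[OF m range])
  also have "\<dots> / t\<^sup>2 \<le> 2 * (harm n)\<^sup>2 * pochhammer (real m) 4 / t\<^sup>2"
    by (intro divide_right_mono mult_right_mono sum_harmonic_weight_squared_le pochhammer_nonneg) (use m in auto)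
  also have "(\<lambda>\<omega>. \<Sum>j\<in>{a<..n}. X j \<omega>) = increment_sum a"
    by (auto simp: increment_sum_def harmonic_pair_sum_eq_weighted X_def)
  finally show ?thesis by (simp add: mult_ac)
qed

end

section \<open>Concentration of the number of parallel pairs\<close>

definition br_mean_pairs :: "nat \<Rightarrow> nat \<Rightarrow> (nat \<Rightarrow> 'a \<Rightarrow> real) \<Rightarrow> 'a \<Rightarrow> real" where
  "br_mean_pairs m n w \<omega> = (\<Sum>i=1..n. mean_count m (\<lambda>k. partial_W w k \<omega>) i)"

context bollobas_riordan
begin

lemma br_mean_pairs_measurable [measurable]: "random_variable borel (br_mean_pairs m n w)"
proof -
  have "random_variable borel (\<lambda>\<omega>. \<Sum>j\<in>{1..<i}. (root_gap m (W \<omega>) j)\<^sup>2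
      / (sqrt (partial_W w k \<omega>) * sqrt (partial_W w k' \<omega>)))"
    if i: "i \<in> {1..n}" and pair: "(k, k') \<in> block_pairs m i" for i k k'
  proof -
    have [measurable]: "random_variable borel (partial_W w k)"
          "random_variable borel (partial_W w k')"
      using pair block_subset[OF i]
      by (auto simp: block_pairs_def intro!: partial_W_random_variable)
    have [measurable]: "random_variable borel (\<lambda>\<omega>. root_gap m (W \<omega>) j)" if "j \<in> {1..<i}" for j
    proof -
      have "j \<le> n" "j - 1 \<le> n" using that i by auto
      from this[THEN partial_W_block_random_variable] show ?thesis
        unfolding root_gap_def by measurable
    qed
    show ?thesis by measurable
  qed
  then show ?thesis
    unfolding br_mean_pairs_def[abs_def] mean_count_def by (intro borel_measurable_sum) auto
qed

lemma AE_attachment_weights: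
  assumes "1 \<le> m"
  shows "AE \<omega> in M. attachment_weights m n (W \<omega>)"
  using AE_w_pos
proof eventually_elim
  case (elim \<omega>)
  then show ?case
    using assms partial_W_strict_mono_on[of "N + 1" w \<omega>] by (simp add: attachment_weights_def)
qed

lemma l_model_eq: "l_model k z = ratio_R N w_model k z * (snd z k)\<^sup>2"
  by (simp add: l_model_def ratio_R_def partial_W_def w_model_def)

lemma partial_W_model: "partial_W w_model k (\<omega>, u) = partial_W w k \<omega>"
  by (simp add: partial_W_def w_model_def)

lemma AE_br_parallel_pairs_model:
  assumes "attachment_weights m n (W \<omega>)"
  shows "AE u in U. br_parallel_pairs m n w_model l_model (\<omega>, u)
    = (\<Sum>i=1..n. block_count m (W \<omega>) i u)"
  using AE_uniforms
  by eventually_elim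
    (intro attachment_weights.br_parallel_pairs_eq_sum[OF assms],
      simp_all add: partial_W_model l_model_eq)

lemma AE_br_parallel_pairs_le_edge_reduction:
  assumes m: "1 \<le> m"
  shows "AE \<omega> in M. real (br_parallel_pairs m n w l \<omega>) \<le> real m * br_edge_reduction m n w l \<omega>"
proof -
  let ?Q = "\<lambda>f :: nat \<Rightarrow> nat set. real (num_parallel_pairs {1..N} f)
      \<le> real m * edge_reduction {1..N} f"
  have "AE z in M \<Otimes>\<^sub>M U. ?Q (br_graph m n w_model l_model z)"
  proof (rule MU.AE_pair_measure)
    show "{z\<in>space (M \<Otimes>\<^sub>M U). ?Q (br_graph m n w_model l_model z)} \<in> sets (M \<Otimes>\<^sub>M U)"
      by (rule sets_Collect_br_graph_model)
    show "AE \<omega> in M. AE u in U. ?Q (br_graph m n w_model l_model (\<omega>, u))"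
      using AE_attachment_weights[OF m]
    proof eventually_elim
      case (elim \<omega>)
      interpret attachment_weights m n "W \<omega>" by fact
      show ?case using AE_uniforms
      proof eventually_elim
        case (elim u)
        have "card {j\<in>{1..N}. j < k \<and> parallel_edges (br_ends m n w_model l_model (\<omega>, u)) j k} \<le> m"
          if "k \<in> {1..N}" for k
          using elim that
          by (intro card_parallel_le[where u=u]) (auto simp: partial_W_model l_model_eq)
        then show ?case
          unfolding br_graph_def num_parallel_pairs_restrict edge_reduction_restrict
          by (intro num_parallel_pairs_le_edge_reduction) auto
      qed
    qed
  qed
  then have "AE \<omega> in M. ?Q (br_graph m n w l \<omega>)" by (rule AE_br_graph_iff_model[of ?Q, THEN iffD2])
  then show ?thesis by (simp add: br_parallel_pairs_eq_br_graph br_edge_reduction_eq_br_graph)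
qed

lemma measure_fibre_parallel_pairs_deviation_le:
  assumes weights: "attachment_weights m n (W \<omega>)" and t: "0 < t"
    and mean: "\<bar>br_mean_pairs m n w \<omega> - x\<bar> \<le> b"
  shows "measure U (Pair \<omega> -` {z\<in>space (M \<Otimes>\<^sub>M U). \<bar>real (br_parallel_pairs m n w_model l_model z) - x\<bar> > b + t})
    \<le> real (m choose 2) * (x + b) / t\<^sup>2" (is "measure U ?B \<le> _")
proof -
  interpret attachment_weights m n "W \<omega>" by (rule weights)
  let ?S = "\<lambda>u. \<Sum>i=1..n. real (block_count m (W \<omega>) i u)"
  have [measurable]: "?S \<in> borel_measurable U"
    by (intro borel_measurable_sum block_count_random_variable)
  have "measure U ?B \<le> measure U {u\<in>space U. \<bar>?S u - br_mean_pairs m n w \<omega>\<bar> \<ge> t}"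
  proof (rule MU.M2.finite_measure_mono_AE)
    show "AE u in U. u \<in> ?B \<longrightarrow> u \<in> {u\<in>space U. \<bar>?S u - br_mean_pairs m n w \<omega>\<bar> \<ge> t}"
      using AE_br_parallel_pairs_model[OF weights] AE_space
    proof eventually_elim
      case (elim u)
      then show ?case using mean by auto
    qed
  qed measurable
  also have "\<dots> \<le> real (m choose 2) * br_mean_pairs m n w \<omega> / t\<^sup>2"
    unfolding br_mean_pairs_def using t by (rule block_count_deviation)
  also have "\<dots> \<le> real (m choose 2) * (x + b) / t\<^sup>2"
    using mean by (intro divide_right_mono mult_left_mono) auto
  finally show ?thesis .
qed

lemma prob_parallel_pairs_deviation_le:
  assumes m: "1 \<le> m" and t: "0 < t" and "0 \<le> x + b"
  shows "prob {\<omega>\<in>space M. \<bar>real (br_parallel_pairs m n w l \<omega>) - x\<bar> > b + t}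
    \<le> prob {\<omega>\<in>space M. \<bar>br_mean_pairs m n w \<omega> - x\<bar> > b} + real (m choose 2) * (x + b) / t\<^sup>2"
proof -
  let ?A = "{\<omega>\<in>space M. \<bar>br_mean_pairs m n w \<omega> - x\<bar> > b}"
  let ?B = "{z\<in>space (M \<Otimes>\<^sub>M U). \<bar>real (br_parallel_pairs m n w_model l_model z) - x\<bar> > b + t}"
  have "prob {\<omega>\<in>space M. \<bar>real (br_parallel_pairs m n w l \<omega>) - x\<bar> > b + t} = measure (M \<Otimes>\<^sub>M U) ?B"
    unfolding br_parallel_pairs_eq_br_graph by (rule prob_br_graph_eq_model)
  also have "\<dots> \<le> prob ?A + real (m choose 2) * (x + b) / t\<^sup>2"
  proof (rule MU.prob_le_exceptional)
    show "AE \<omega> in M. \<omega> \<notin> ?A \<longrightarrow> measure U (Pair \<omega> -` ?B) \<le> real (m choose 2) * (x + b) / t\<^sup>2"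
      using AE_attachment_weights[OF m] AE_space
    proof (eventually_elim, intro impI measure_fibre_parallel_pairs_deviation_le t)
      fix \<omega> assume "\<omega> \<in> space M" "\<omega> \<notin> ?A"
      then show "\<bar>br_mean_pairs m n w \<omega> - x\<bar> \<le> b" by auto
    qed
    show "0 \<le> real (m choose 2) * (x + b) / t\<^sup>2" using \<open>0 \<le> x + b\<close> by simp
    show "?B \<in> sets (M \<Otimes>\<^sub>M U)"
      unfolding br_parallel_pairs_eq_br_graph by (rule sets_Collect_br_graph_model)
  qed measurable
  finally show ?thesis .
qed

lemma br_mean_pairs_bounds:
  assumes weights: "attachment_weights m n (W \<omega>)" and near: "near_linear \<delta> a \<omega>"
    and \<delta>: "0 < \<delta>" "\<delta> < 1" and a: "1 / \<delta> \<le> real a" "a \<le> n"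
  shows "mean_coefficient m / (1 + \<delta>)\<^sup>2 * increment_sum a \<omega> \<le> br_mean_pairs m n w \<omega>"
    and "br_mean_pairs m n w \<omega> \<le> real (m choose 2) * real a * (1 + (1 + \<delta>) / (1 - \<delta>)\<^sup>2 * harm n)
      + mean_coefficient m / (1 - \<delta>) ^ 4 * increment_sum a \<omega>"
proof -
  interpret near_linear_weights m n "W \<omega>" \<delta> a
    using weights near \<delta> a
    by (intro near_linear_weights.intro near_linear_weights_axioms.intro)
       (auto simp: near_linear_def less_imp_le)
  show "mean_coefficient m / (1 + \<delta>)\<^sup>2 * increment_sum a \<omega> \<le> br_mean_pairs m n w \<omega>"
    unfolding br_mean_pairs_def increment_sum_def by (rule sum_mean_count_ge)
  show "br_mean_pairs m n w \<omega> \<le> real (m choose 2) * real a * (1 + (1 + \<delta>) / (1 - \<delta>)\<^sup>2 * harm n)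
      + mean_coefficient m / (1 - \<delta>) ^ 4 * increment_sum a \<omega>"
    unfolding br_mean_pairs_def increment_sum_def by (rule sum_mean_count_le)
qed

lemma prob_mean_pairs_deviation_le:
  fixes a :: nat
  defines "h \<equiv> real m * (real m + 1) * harmonic_pair_sum a n (\<lambda>_. 1)"
  assumes m: "1 \<le> m" and \<delta>: "0 < \<delta>" "\<delta> < 1" and a: "1 / \<delta> \<le> real a" "a \<le> n" and t: "0 < t"
    and upper: "real (m choose 2) * real a * (1 + (1 + \<delta>) / (1 - \<delta>)\<^sup>2 * harm n)
      + mean_coefficient m / (1 - \<delta>) ^ 4 * (h + t) \<le> x + b"
    and lower: "x - b \<le> mean_coefficient m / (1 + \<delta>)\<^sup>2 * (h - t)"
  shows "prob {\<omega>\<in>space M. \<bar>br_mean_pairs m n w \<omega> - x\<bar> > b}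
    \<le> 18 / (\<delta> ^ 4 * real a) + 2 * pochhammer (real m) 4 * (harm n)\<^sup>2 / t\<^sup>2"
proof -
  let ?A = "{\<omega>\<in>space M. \<not> near_linear \<delta> a \<omega>}"
  let ?T = "{\<omega>\<in>space M. \<bar>increment_sum a \<omega> - h\<bar> \<ge> t}"
  have [measurable]: "?A \<in> events" by (rule sets.sets_Collect_neg[OF near_linear_measurable])
  have "0 < real a" using less_le_trans[OF _ a(1), of 0] \<delta> by simp
  have "prob {\<omega>\<in>space M. \<bar>br_mean_pairs m n w \<omega> - x\<bar> > b} \<le> prob (?A \<union> ?T)"
  proof (rule finite_measure_mono_AE)
    show "AE \<omega> in M. \<omega> \<in> {\<omega>\<in>space M. \<bar>br_mean_pairs m n w \<omega> - x\<bar> > b} \<longrightarrow> \<omega> \<in> ?A \<union> ?T"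
      using AE_attachment_weights[OF m]
    proof eventually_elim
      case (elim \<omega>)
      have "\<bar>br_mean_pairs m n w \<omega> - x\<bar> \<le> b" if "near_linear \<delta> a \<omega>" "\<bar>increment_sum a \<omega> - h\<bar> < t"
      proof -
        have "mean_coefficient m / (1 + \<delta>)\<^sup>2 * (h - t)
            \<le> mean_coefficient m / (1 + \<delta>)\<^sup>2 * increment_sum a \<omega>"
          "mean_coefficient m / (1 - \<delta>) ^ 4 * increment_sum a \<omega>
            \<le> mean_coefficient m / (1 - \<delta>) ^ 4 * (h + t)"
          using that(2) mean_coefficient_nonneg[of m] by (intro mult_left_mono; auto)+
        then show ?thesis using br_mean_pairs_bounds[OF elim that(1) \<delta> a] upper lower by linarith
      qed
      then show ?case by fastforce
    qed
  qed measurable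
  also have "\<dots> \<le> prob ?A + prob ?T"
    by (intro measure_Un_le) auto
  also have "\<dots> \<le> 18 / (\<delta> ^ 4 * real a) + 2 * pochhammer (real m) 4 * (harm n)\<^sup>2 / t\<^sup>2"
    unfolding h_def
    using \<open>0 < real a\<close>
    by (intro add_mono prob_not_near_linear_le increment_sum_deviation m \<delta> t) auto
  finally show ?thesis .
qed

end

section \<open>The limit of the number of parallel pairs\<close>

lemma mean_coefficient_eq:
  assumes "1 \<le> m"
  shows "mean_coefficient m * (real m * (real m + 1) / 2) = ((real m)\<^sup>2 - 1) / 16"
proof -
  have choose_two: "real (m choose 2) = real m * (real m - 1) / 2"
    by (induction m) (auto simp: numeral_2_eq_2 field_simps)
  show ?thesis
    unfolding mean_coefficient_def choose_two
    using assms by (simp add: field_simps power2_eq_square)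
qed

lemma harm_squared_div_tendsto: "(\<lambda>n. x * (harm n)\<^sup>2 / (\<delta> * (ln (real n))\<^sup>2)\<^sup>2) \<longlonglongrightarrow> 0"
proof -
  have "(\<lambda>n. x / \<delta>\<^sup>2 * (harm n / (ln (real n))\<^sup>2)\<^sup>2) \<longlonglongrightarrow> x / \<delta>\<^sup>2 * 0\<^sup>2"
    by (intro tendsto_intros harm_div_ln_squared_tendsto)
  then show ?thesis by (simp add: power_mult_distrib power_divide)
qed

lemma upper_mean_bound_tendsto:
  "(\<lambda>n. (K * (1 + B * harm n) + A * (H * harmonic_pair_sum a n (\<lambda>_. 1) + \<delta> * (ln (real n))\<^sup>2)) / (ln (real n))\<^sup>2)
    \<longlonglongrightarrow> A * (H / 2 + \<delta>)"
proof -
  have "(\<lambda>n. K / (ln (real n))\<^sup>2 + K * B * (harm n / (ln (real n))\<^sup>2)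
      + A * (H * (harmonic_pair_sum a n (\<lambda>_. 1) / (ln (real n))\<^sup>2) + \<delta>))
        \<longlonglongrightarrow> 0 + K * B * 0 + A * (H * (1 / 2) + \<delta>)"
    by (intro tendsto_intros const_div_ln_squared_tendsto harm_div_ln_squared_tendsto
        harmonic_pair_sum_div_ln_squared_tendsto)
  moreover have "\<forall>\<^sub>F n in sequentially. K / (ln (real n))\<^sup>2 + K * B * (harm n / (ln (real n))\<^sup>2)
      + A * (H * (harmonic_pair_sum a n (\<lambda>_. 1) / (ln (real n))\<^sup>2) + \<delta>)
    = (K * (1 + B * harm n) + A * (H * harmonic_pair_sum a n (\<lambda>_. 1) + \<delta> * (ln (real n))\<^sup>2)) / (ln (real n))\<^sup>2"
    using eventually_gt_at_top[of 1] by eventually_elim (simp add: field_simps)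
  ultimately show ?thesis using Lim_transform_eventually by fastforce
qed

lemma lower_mean_bound_tendsto:
  "(\<lambda>n. A * (H * harmonic_pair_sum a n (\<lambda>_. 1) - \<delta> * (ln (real n))\<^sup>2) / (ln (real n))\<^sup>2)
    \<longlonglongrightarrow> A * (H / 2 - \<delta>)"
  using upper_mean_bound_tendsto[of 0 0 A H a "- \<delta>"] by simp

lemma exists_nat_ge_divide_less:
  fixes x y e :: real
  assumes "0 < x" "0 < e"
  obtains a :: nat where "x \<le> real a" "y / real a < e"
proof -
  obtain a :: nat where a: "max x (y / e) < real a" using reals_Archimedean2 by blast
  then have "y < e * real a" using assms by (simp add: pos_divide_less_eq mult.commute)
  then have "y / real a < e" using a assms by (simp add: pos_divide_less_eq)
  moreover have "x \<le> real a" using a by simp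
  ultimately show ?thesis using that by blast
qed

lemma exists_small_perturbation:
  fixes A H \<eta> :: real
  assumes "0 < \<eta>"
  obtains \<delta> where "0 < \<delta>" "\<delta> < 1" "A / (1 - \<delta>) ^ 4 * (H / 2 + \<delta>) < A * (H / 2) + \<eta>"
    "A * (H / 2) - \<eta> < A / (1 + \<delta>)\<^sup>2 * (H / 2 - \<delta>)"
proof -
  have "((\<lambda>\<delta>. A / (1 - \<delta>) ^ 4 * (H / 2 + \<delta>)) \<longlongrightarrow> A / (1 - 0) ^ 4 * (H / 2 + 0)) (at_right 0)"
    by (intro tendsto_intros) auto
  then have "\<forall>\<^sub>F \<delta> in at_right 0. A / (1 - \<delta>) ^ 4 * (H / 2 + \<delta>) < A * (H / 2) + \<eta>"
    using assms by (intro order_tendstoD(2)) auto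
  moreover have "((\<lambda>\<delta>. A / (1 + \<delta>)\<^sup>2 * (H / 2 - \<delta>)) \<longlongrightarrow> A / (1 + 0)\<^sup>2 * (H / 2 - 0)) (at_right 0)"
    by (intro tendsto_intros) auto
  then have "\<forall>\<^sub>F \<delta> in at_right 0. A * (H / 2) - \<eta> < A / (1 + \<delta>)\<^sup>2 * (H / 2 - \<delta>)"
    using assms by (intro order_tendstoD(1)) auto
  moreover have "\<forall>\<^sub>F \<delta> in at_right 0. 0 < \<delta> \<and> \<delta> < (1::real)"
    unfolding eventually_at_right_field by (intro exI[of _ 1]) auto
  ultimately have "\<forall>\<^sub>F \<delta> in at_right 0. 0 < \<delta> \<and> \<delta> < 1 \<and> A / (1 - \<delta>) ^ 4 * (H / 2 + \<delta>)
      < A * (H / 2) + \<eta>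
      \<and> A * (H / 2) - \<eta> < A / (1 + \<delta>)\<^sup>2 * (H / 2 - \<delta>)"
    by eventually_elim blast
  from eventually_happens'[OF _ this] show ?thesis using that by auto
qed

lemma tendsto_in_probability_divide_iff:
  fixes L :: "nat \<Rightarrow> real"
  assumes "\<forall>\<^sub>F n in sequentially. 0 < L n"
  shows "tendsto_in_probability M (\<lambda>n \<omega>. X n \<omega> / L n) c \<longleftrightarrow>
    (\<forall>\<epsilon>>0. (\<lambda>n. measure (M n) {\<omega>\<in>space (M n). \<bar>X n \<omega> - c * L n\<bar> > \<epsilon> * L n}) \<longlonglongrightarrow> 0)"
proof -
  have "\<forall>\<^sub>F n in sequentially. measure (M n) {\<omega>\<in>space (M n). \<bar>X n \<omega> / L n - c\<bar> > \<epsilon>}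
      = measure (M n) {\<omega>\<in>space (M n). \<bar>X n \<omega> - c * L n\<bar> > \<epsilon> * L n}" for \<epsilon>
    using assms
  proof eventually_elim
    case (elim n)
    have "X n \<omega> / L n - c = (X n \<omega> - c * L n) / L n" for \<omega>
      using elim by (simp add: diff_divide_distrib)
    then show ?case using elim by (simp add: pos_less_divide_eq)
  qed
  from filterlim_cong[OF refl refl this] show ?thesis
    by (simp only: tendsto_in_probability_def)
qed

lemma ln_squared_pos: "\<forall>\<^sub>F n in sequentially. 0 < (ln (real n))\<^sup>2"
  using eventually_gt_at_top[of 1] by eventually_elim simp

locale bollobas_riordan_graphs =
  fixes m :: nat and M :: "nat \<Rightarrow> 'a measure" and w l :: "nat \<Rightarrow> nat \<Rightarrow> 'a \<Rightarrow> real"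
  assumes m_pos: "1 \<le> m"
    and graph: "\<And>n. 1 \<le> n \<Longrightarrow> bollobas_riordan (M n) m n (w n) (l n)"
begin

definition parallel_limit :: real where
  "parallel_limit = ((real m)\<^sup>2 - 1) / 16"

lemma parallel_limit_nonneg: "0 \<le> parallel_limit"
  using m_pos by (simp add: parallel_limit_def)

lemma parallel_limit_pos: "2 \<le> m \<Longrightarrow> 0 < parallel_limit"
  by (simp add: parallel_limit_def one_less_power)

lemma mean_pairs_tendsto_in_probability:
  "tendsto_in_probability M (\<lambda>n \<omega>. br_mean_pairs m n (w n) \<omega> / (ln (real n))\<^sup>2) parallel_limit"
  unfolding tendsto_in_probability_divide_iff[OF ln_squared_pos]
proof (intro allI impI tendstoI)
  fix \<eta> \<epsilon> :: real assume "0 < \<eta>" "0 < \<epsilon>"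
  define H where "H = real m * (real m + 1)"
  have parallel_limit: "parallel_limit = mean_coefficient m * (H / 2)"
    unfolding H_def parallel_limit_def by (rule mean_coefficient_eq[OF m_pos, symmetric])
  obtain \<delta> where \<delta>: "0 < \<delta>" "\<delta> < 1"
    "mean_coefficient m / (1 - \<delta>) ^ 4 * (H / 2 + \<delta>) < parallel_limit + \<eta>"
    "parallel_limit - \<eta> < mean_coefficient m / (1 + \<delta>)\<^sup>2 * (H / 2 - \<delta>)"
    unfolding parallel_limit using \<open>0 < \<eta>\<close> by (rule exists_small_perturbation)
  have "0 < 1 / \<delta>" "0 < \<epsilon> / 2" using \<delta>(1) \<open>0 < \<epsilon>\<close> by simp_all
  then obtain a :: nat where a: "1 / \<delta> \<le> real a" "18 / \<delta> ^ 4 / real a < \<epsilon> / 2"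
    by (rule exists_nat_ge_divide_less)
  have chebyshev: "\<forall>\<^sub>F n in sequentially.
      2 * pochhammer (real m) 4 * (harm n)\<^sup>2 / (\<delta> * (ln (real n))\<^sup>2)\<^sup>2 < \<epsilon> / 2"
    using \<open>0 < \<epsilon>\<close> by (intro order_tendstoD(2)[OF harm_squared_div_tendsto]) simp
  show "\<forall>\<^sub>F n in sequentially. dist (measure (M n) {\<omega>\<in>space (M n).
      \<bar>br_mean_pairs m n (w n) \<omega> - parallel_limit * (ln (real n))\<^sup>2\<bar> > \<eta> * (ln (real n))\<^sup>2}) 0 < \<epsilon>"
    using order_tendstoD(2)[OF upper_mean_bound_tendsto[where a=a and K="real (m choose 2) * real a"
          and B="(1 + \<delta>) / (1 - \<delta>)\<^sup>2"] \<delta>(3)]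
      order_tendstoD(1)[OF lower_mean_bound_tendsto[where a=a] \<delta>(4)]
      chebyshev ln_squared_pos eventually_ge_at_top[of "max a 1"]
  proof eventually_elim
    case (elim n)
    interpret bollobas_riordan "M n" m n "w n" "l n" using elim by (intro graph) simp
    have "prob {\<omega>\<in>space (M n). \<bar>br_mean_pairs m n (w n) \<omega>
        - parallel_limit * (ln (real n))\<^sup>2\<bar> > \<eta> * (ln (real n))\<^sup>2}
      \<le> 18 / (\<delta> ^ 4 * real a) + 2 * pochhammer (real m) 4 * (harm n)\<^sup>2 / (\<delta> * (ln (real n))\<^sup>2)\<^sup>2"
    proof (rule prob_mean_pairs_deviation_le[OF m_pos \<delta>(1,2) a(1)])
      show "real (m choose 2) * real a * (1 + (1 + \<delta>) / (1 - \<delta>)\<^sup>2 * harm n)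
          + mean_coefficient m / (1 - \<delta>) ^ 4 *
          (real m * (real m + 1) * harmonic_pair_sum a n (\<lambda>_. 1) + \<delta> * (ln (real n))\<^sup>2)
        \<le> parallel_limit * (ln (real n))\<^sup>2 + \<eta> * (ln (real n))\<^sup>2"
        using elim(1,4)
        by (simp only: H_def pos_divide_less_eq distrib_right[symmetric] less_imp_le)
      show "parallel_limit * (ln (real n))\<^sup>2 - \<eta> * (ln (real n))\<^sup>2
          \<le> mean_coefficient m / (1 + \<delta>)\<^sup>2 *
          (real m * (real m + 1) * harmonic_pair_sum a n (\<lambda>_. 1) - \<delta> * (ln (real n))\<^sup>2)"
        using elim(2,4)
        by (simp only: H_def pos_less_divide_eq left_diff_distrib[symmetric] less_imp_le)
    qed (use elim \<delta> in auto)
    then show ?case using a(2) elim(3) by (simp add: dist_real_def)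
  qed
qed

theorem parallel_pairs_tendsto_in_probability:
  "tendsto_in_probability M (\<lambda>n \<omega>. real (br_parallel_pairs m n (w n) (l n) \<omega>) / (ln (real n))\<^sup>2) parallel_limit"
  unfolding tendsto_in_probability_divide_iff[OF ln_squared_pos]
proof (intro allI impI)
  fix \<epsilon> :: real assume "0 < \<epsilon>"
  define \<eta> where "\<eta> = \<epsilon> / 2"
  have \<eta>: "0 < \<eta>" using \<open>0 < \<epsilon>\<close> by (simp add: \<eta>_def)
  let ?P = "\<lambda>n. measure (M n) {\<omega>\<in>space (M n).
    \<bar>real (br_parallel_pairs m n (w n) (l n) \<omega>)
      - parallel_limit * (ln (real n))\<^sup>2\<bar> > \<epsilon> * (ln (real n))\<^sup>2}"
  let ?Y = "\<lambda>n. measure (M n) {\<omega>\<in>space (M n).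
    \<bar>br_mean_pairs m n (w n) \<omega> - parallel_limit * (ln (real n))\<^sup>2\<bar> > \<eta> * (ln (real n))\<^sup>2}"
  let ?e = "\<lambda>n. real (m choose 2) * (parallel_limit + \<eta>) / \<eta>\<^sup>2 / (ln (real n))\<^sup>2"
  show "?P \<longlonglongrightarrow> 0"
  proof (rule tendsto_sandwich[OF _ _ tendsto_const])
    show "\<forall>\<^sub>F n in sequentially. ?P n \<le> ?Y n + ?e n"
      using ln_squared_pos eventually_ge_at_top[of 1]
    proof eventually_elim
      case (elim n)
      interpret bollobas_riordan "M n" m n "w n" "l n" using elim(2) by (rule graph)
      let ?L = "(ln (real n))\<^sup>2"
      have "\<epsilon> * ?L = \<eta> * ?L + \<eta> * ?L" by (simp add: \<eta>_def)
      moreover have "?e n = real (m choose 2) * (parallel_limit * ?L + \<eta> * ?L) / (\<eta> * ?L)\<^sup>2"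
        unfolding distrib_right[symmetric] using elim(1) by (simp add: power2_eq_square)
      moreover have "0 \<le> parallel_limit * ?L + \<eta> * ?L"
        using parallel_limit_nonneg \<eta> by (intro add_nonneg_nonneg mult_nonneg_nonneg) auto
      ultimately show ?case
        using prob_parallel_pairs_deviation_le[OF m_pos, of "\<eta> * ?L" "parallel_limit * ?L" "\<eta> * ?L"]
          \<eta> elim(1)
        by (simp only:) auto
    qed
    have "?Y \<longlonglongrightarrow> 0"
      using mean_pairs_tendsto_in_probability \<eta>
      unfolding tendsto_in_probability_divide_iff[OF ln_squared_pos] by blast
    from tendsto_add[OF this
        const_div_ln_squared_tendsto[of "real (m choose 2) * (parallel_limit + \<eta>) / \<eta>\<^sup>2"]]
    show "(\<lambda>n. ?Y n + ?e n) \<longlonglongrightarrow> 0" by simp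
  qed auto
qed

lemma eventually_prob_space: "\<forall>\<^sub>F n in sequentially. prob_space (M n)"
  using eventually_ge_at_top[of 1] by eventually_elim (rule bollobas_riordan.axioms(1)[OF graph])

lemma eventually_parallel_pairs_measurable:
  "\<forall>\<^sub>F n in sequentially. (\<lambda>\<omega>. real (br_parallel_pairs m n (w n) (l n) \<omega>) / (ln (real n))\<^sup>2)
    \<in> borel_measurable (M n)"
  using eventually_ge_at_top[of 1]
proof eventually_elim
  case (elim n)
  interpret bollobas_riordan "M n" m n "w n" "l n" using elim by (rule graph)
  show ?case
    unfolding br_parallel_pairs_eq_br_graph
    by (rule measurable_compose[OF br_graph_random_variable]) simp
qed

lemma eventually_sets_Collect_edge_reduction:
  "\<forall>\<^sub>F n in sequentially. {\<omega>\<in>space (M n). Q n (br_edge_reduction m n (w n) (l n) \<omega>)} \<in> sets (M n)"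
  using eventually_ge_at_top[of 1]
proof eventually_elim
  case (elim n)
  interpret bollobas_riordan "M n" m n "w n" "l n" using elim by (rule graph)
  show ?case unfolding br_edge_reduction_eq_br_graph by (rule sets_Collect_br_graph)
qed

lemma parallel_pairs_concentrated:
  "0 < \<epsilon> \<Longrightarrow> with_high_probability M
    (\<lambda>n \<omega>. \<bar>real (br_parallel_pairs m n (w n) (l n) \<omega>) / (ln (real n))\<^sup>2 - parallel_limit\<bar> \<le> \<epsilon>)"
  by (rule tendsto_in_probability_imp_with_high_probability[OF parallel_pairs_tendsto_in_probability _
        eventually_prob_space eventually_parallel_pairs_measurable])

theorem edge_reduction_upper:
  "with_high_probability M (\<lambda>n \<omega>. br_edge_reduction m n (w n) (l n) \<omega>
    \<le> (parallel_limit + 1) * (ln (real n))\<^sup>2)"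
proof (rule with_high_probability_mono_AE[OF parallel_pairs_concentrated[OF zero_less_one]
      eventually_prob_space eventually_sets_Collect_edge_reduction])
  let ?P = "\<lambda>n \<omega>. real (br_parallel_pairs m n (w n) (l n) \<omega>)"
  show "\<forall>\<^sub>F n in sequentially. AE \<omega> in M n. \<bar>?P n \<omega> / (ln (real n))\<^sup>2 - parallel_limit\<bar> \<le> 1 \<longrightarrow>
      br_edge_reduction m n (w n) (l n) \<omega> \<le> (parallel_limit + 1) * (ln (real n))\<^sup>2"
    using ln_squared_pos
  proof (eventually_elim, intro AE_I2 impI)
    fix n \<omega> assume ln_pos: "0 < (ln (real n))\<^sup>2"
      and near: "\<bar>?P n \<omega> / (ln (real n))\<^sup>2 - parallel_limit\<bar> \<le> 1"
    have "br_edge_reduction m n (w n) (l n) \<omega> \<le> ?P n \<omega>"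
      unfolding br_edge_reduction_def br_parallel_pairs_def
      by (rule edge_reduction_le_num_parallel_pairs) simp
    also have "?P n \<omega> / (ln (real n))\<^sup>2 \<le> parallel_limit + 1" using near by linarith
    then have "?P n \<omega> \<le> (parallel_limit + 1) * (ln (real n))\<^sup>2"
      using ln_pos by (simp only: pos_divide_le_eq)
    finally show "br_edge_reduction m n (w n) (l n) \<omega> \<le> (parallel_limit + 1) * (ln (real n))\<^sup>2" .
  qed
qed

theorem edge_reduction_lower:
  assumes "2 \<le> m"
  shows "with_high_probability M
    (\<lambda>n \<omega>. parallel_limit / (2 * real m) * (ln (real n))\<^sup>2 \<le> br_edge_reduction m n (w n) (l n) \<omega>)"
proof (rule with_high_probability_mono_AE[OF parallel_pairs_concentrated
      eventually_prob_space eventually_sets_Collect_edge_reduction])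
  let ?P = "\<lambda>n \<omega>. real (br_parallel_pairs m n (w n) (l n) \<omega>)"
  show "0 < parallel_limit / 2" using parallel_limit_pos[OF assms] by simp
  show "\<forall>\<^sub>F n in sequentially. AE \<omega> in M n. \<bar>?P n \<omega> / (ln (real n))\<^sup>2 - parallel_limit\<bar>
      \<le> parallel_limit / 2 \<longrightarrow>
      parallel_limit / (2 * real m) * (ln (real n))\<^sup>2 \<le> br_edge_reduction m n (w n) (l n) \<omega>"
    using ln_squared_pos eventually_ge_at_top[of 1]
  proof eventually_elim
    case (elim n)
    interpret bollobas_riordan "M n" m n "w n" "l n" using elim(2) by (rule graph)
    show ?case
      using AE_br_parallel_pairs_le_edge_reduction[OF m_pos]
    proof (eventually_elim, intro impI)
      fix \<omega> assume pairs: "?P n \<omega> \<le> real m * br_edge_reduction m n (w n) (l n) \<omega>"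
        and near: "\<bar>?P n \<omega> / (ln (real n))\<^sup>2 - parallel_limit\<bar> \<le> parallel_limit / 2"
      have "parallel_limit / 2 \<le> ?P n \<omega> / (ln (real n))\<^sup>2" using near by linarith
      then have "parallel_limit / 2 * (ln (real n))\<^sup>2 \<le> ?P n \<omega>"
        using elim(1) by (simp only: pos_le_divide_eq)
      also note pairs
      finally show "parallel_limit / (2 * real m) * (ln (real n))\<^sup>2
          \<le> br_edge_reduction m n (w n) (l n) \<omega>"
        using m_pos by (simp add: field_simps)
    qed
  qed
qed

end

theorem theorem2p6:
  fixes m :: nat and M :: "nat \<Rightarrow> 'a measure" and w l :: "nat \<Rightarrow> nat \<Rightarrow> 'a \<Rightarrow> real"
  assumes "m \<ge> 1"
    and "\<And>n. n \<ge> 1 \<Longrightarrow> bollobas_riordan (M n) m n (w n) (l n)"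
  shows "tendsto_in_probability M
           (\<lambda>n \<omega>. real (br_parallel_pairs m n (w n) (l n) \<omega>) / (ln (real n))\<^sup>2)
           (((real m)\<^sup>2 - 1) / 16)
         \<and> (\<exists>C>0. with_high_probability M
             (\<lambda>n \<omega>. br_edge_reduction m n (w n) (l n) \<omega> \<le> C * (ln (real n))\<^sup>2))
         \<and> (m \<ge> 2 \<longrightarrow> (\<exists>c>0. with_high_probability M
             (\<lambda>n \<omega>. c * (ln (real n))\<^sup>2 \<le> br_edge_reduction m n (w n) (l n) \<omega>)))"
proof (intro conjI impI)
  interpret bollobas_riordan_graphs m M w l
    using assms by (rule bollobas_riordan_graphs.intro)
  show "tendsto_in_probability M
      (\<lambda>n \<omega>. real (br_parallel_pairs m n (w n) (l n) \<omega>) / (ln (real n))\<^sup>2) (((real m)\<^sup>2 - 1) / 16)"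
    using parallel_pairs_tendsto_in_probability by (simp only: parallel_limit_def)
  have "0 < parallel_limit + 1" using parallel_limit_nonneg by linarith
  then show "\<exists>C>0. with_high_probability M
      (\<lambda>n \<omega>. br_edge_reduction m n (w n) (l n) \<omega> \<le> C * (ln (real n))\<^sup>2)"
    using edge_reduction_upper by blast
  assume "2 \<le> m"
  then have "0 < parallel_limit / (2 * real m)" using parallel_limit_pos by simp
  then show "\<exists>c>0. with_high_probability M
      (\<lambda>n \<omega>. c * (ln (real n))\<^sup>2 \<le> br_edge_reduction m n (w n) (l n) \<omega>)"
    using edge_reduction_lower[OF \<open>2 \<le> m\<close>] by blast
qed

end
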